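(* Let $y_0\in Y$ and assume that $\mathcal{U}(y_0)\neq\emptyset$. Then $$\limsup_{T\rightarrow\infty}\Gamma_T(y_0)\subset W_2(y_0),\qquad \liminf_{T\rightarrow\infty}v_T(y_0)\geq d^*(y_0),$$ and $$\limsup_{\lambda\rightarrow 0+}\Theta^{\lambda}(y_0)\subset W_2(y_0),\qquad \liminf_{\lambda\rightarrow 0+}h^{\lambda}(y_0)\geq d^*(y_0).$$
   Context: Setting. $U$ is a compact metric space, $f:\mathbb{R}^m\times U\to\mathbb{R}^m$ is continuous in $(y,u)$ and Lipschitz in $y$ uniformly in $u\in U$, $k:\mathbb{R}^m\times U\to\mathbb{R}$ is continuous, and $Y\subset\mathbb{R}^m$ is a compact set which is the closure of its interior. The control system is $y'(t)=f(y(t),u(t))$, $u(t)\in U$, $t\in[0,\infty)$. Controls are measurable functions $u(\cdot):[0,\infty)\to U$; $\mathcal{U}$ is the set of all controls, and $y(t,y_0,u)$ is the solution with control $u(\cdot)$ and $y(0)=y_0$. $\mathcal{U}_T(y_0)$ (resp. $\mathcal{U}(y_0)$) is the set of controls such that $y(t,y_0,u)\in Y$ for all $t\in[0,T]$ (resp. for all $t\in[0,\infty)$). Optimal values: for $T>0$, $\lambda>0$, $$v_T(y_0)=\frac1T\inf_{u(\cdot)\in\mathcal{U}_T(y_0)}\int_0^Tk(y(t,y_0,u),u(t))\,dt,\qquad h^\lambda(y_0)=\lambda\inf_{u(\cdot)\in\mathcal{U}(y_0)}\int_0^\infty e^{-\lambda t}k(y(t,y_0,u),u(t))\,dt.$$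 Measures. $\mathcal{P}(Y\times U)$ and $\mathcal{M}_+(Y\times U)$ are the Borel probability measures and the finite non-negative Borel measures on $Y\times U$, with weak$^*$ convergence (tested against continuous functions on $Y\times U$). For $u(\cdot)\in\mathcal{U}_T(y_0)$ the occupational measure $\gamma_{u(\cdot),T}\in\mathcal{P}(Y\times U)$ is defined by $\int q\,d\gamma_{u(\cdot),T}=\frac1T\int_0^Tq(y(t,y_0,u),u(t))\,dt$ for all $q\in C(Y\times U)$. For $u(\cdot)\in\mathcal{U}(y_0)$ the discounted occupational measure $\gamma^\lambda_{u(\cdot)}\in\mathcal{P}(Y\times U)$ is defined by $\int q\,d\gamma^\lambda_{u(\cdot)}=\lambda\int_0^\infty e^{-\lambda t}q(y(t,y_0,u),u(t))\,dt$ for all $q\in C(Y\times U)$. Put $\Gamma_T(y_0)=\{\gamma_{u(\cdot),T}:u(\cdot)\in\mathcal{U}_T(y_0)\}$ and $\Theta^\lambda(y_0)=\{\gamma^\lambda_{u(\cdot)}:u(\cdot)\in\mathcal{U}(y_0)\}$. $\limsup_{T\to\infty}\Gamma_T(y_0)$ is the set of all weak$^*$ limits of sequences $\gamma_l\in\Gamma_{T_l}(y_0)$ with $T_l\to\infty$; $\limsup_{\lambda\to0+}\Theta^\lambda(y_0)$ is the set of all weak$^*$ limits of sequences $\gamma_l\in\Theta^{\lambda_l}(y_0)$ with $\lambda_l\to0+$. $C^1$ is the space of continuously differentiable functions $\phi:\mathbb{R}^m\to\mathbb{R}$. Define $$W=\Big\{\gamma\in\mathcal{P}(Y\times U):\int_{Y\times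 U}\nabla\phi(y)^Tf(y,u)\,\gamma(dy,du)=0\ \ \forall\phi\in C^1\Big\},$$ and let $W_2(y_0)$ be the set of $\gamma\in W$ for which there exists a sequence $\xi_l\in\mathcal{M}_+(Y\times U)$, $l=1,2,\dots$, such that $$\int_{Y\times U}(\phi(y)-\phi(y_0))\,\gamma(dy,du)=\lim_{l\to\infty}\int_{Y\times U}\nabla\phi(y)^Tf(y,u)\,\xi_l(dy,du)\quad\forall\phi\in C^1.$$ $d^*(y_0)=\sup\mu$, the supremum being over all triplets $(\mu,\psi,\eta)\in\mathbb{R}\times C^1\times C^1$ such that for all $(y,u)\in Y\times U$: $k(y,u)+(\psi(y_0)-\psi(y))+\nabla\eta(y)^Tf(y,u)-\mu\ge0$ and $\nabla\psi(y)^Tf(y,u)\ge0$. *)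

theory Defs
  imports "HOL-Probability.Probability"
begin

subsection \<open>Continuously differentiable functions\<close>

definition grad :: "(real ^ 'm \<Rightarrow> real) \<Rightarrow> real ^ 'm \<Rightarrow> real ^ 'm" where
  "grad \<phi> y = (THE D. GDERIV \<phi> y :> D)"

definition C1 :: "(real ^ 'm \<Rightarrow> real) set" where
  "C1 = {\<phi>. (\<forall>y. \<phi> differentiable (at y)) \<and> continuous_on UNIV (grad \<phi>)}"

subsection \<open>The control system\<close>

text \<open>
  Functions on the time axis \<open>[0, \<infinity>)\<close> are functions on the reals of which only the values at
  nonnegative times matter.  Measurability of controls is Lebesgue measurability.
\<close>

definition controls :: "('u::metric_space) set \<Rightarrow> (real \<Rightarrow> 'u) set" where
  "controls U = lebesgue_on {0..} \<rightarrow>\<^sub>M restrict_space borel U"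

text \<open>
  For a merely measurable control, solutions of \<open>y'(t) = f(y(t), u(t))\<close> are meant in the sense of
  Caratheodory, that is, as solutions of the integral equation.
\<close>

definition is_solution ::
  "((real ^ 'm) \<times> 'u \<Rightarrow> real ^ 'm) \<Rightarrow> real ^ 'm \<Rightarrow> (real \<Rightarrow> 'u) \<Rightarrow> (real \<Rightarrow> real ^ 'm) \<Rightarrow> bool" where
  "is_solution f y0 u y \<longleftrightarrow>
    (\<forall>t\<ge>0. set_integrable lebesgue {0..t} (\<lambda>s. f (y s, u s)) \<and>
           y t = y0 + (LINT s:{0..t}|lebesgue. f (y s, u s)))"

text \<open>
  Under the standing assumptions (\<open>f\<close> continuous and Lipschitz in the state, uniformly in the
  control, with compact control set) the solution exists and is unique on \<open>[0, \<infinity>)\<close>; the choice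
  operator only leaves the irrelevant values at negative times undetermined.
\<close>

definition trajectory ::
  "((real ^ 'm) \<times> 'u \<Rightarrow> real ^ 'm) \<Rightarrow> real ^ 'm \<Rightarrow> (real \<Rightarrow> 'u) \<Rightarrow> real \<Rightarrow> real ^ 'm" where
  "trajectory f y0 u = (SOME y. is_solution f y0 u y)"

definition admissible_upto ::
  "((real ^ 'm) \<times> 'u::metric_space \<Rightarrow> real ^ 'm) \<Rightarrow> 'u set \<Rightarrow> (real ^ 'm) set \<Rightarrow> real ^ 'm
    \<Rightarrow> real \<Rightarrow> (real \<Rightarrow> 'u) set" where
  "admissible_upto f U Y y0 T = {u \<in> controls U. \<forall>t\<in>{0..T}. trajectory f y0 u t \<in> Y}"

definition admissible ::
  "((real ^ 'm) \<times> 'u::metric_space \<Rightarrow> real ^ 'm) \<Rightarrow> 'u set \<Rightarrow> (real ^ 'm) set \<Rightarrow> real ^ 'm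
    \<Rightarrow> (real \<Rightarrow> 'u) set" where
  "admissible f U Y y0 = {u \<in> controls U. \<forall>t\<ge>0. trajectory f y0 u t \<in> Y}"

definition time_average ::
  "((real ^ 'm) \<times> 'u \<Rightarrow> real ^ 'm) \<Rightarrow> real ^ 'm \<Rightarrow> (real \<Rightarrow> 'u) \<Rightarrow> real
    \<Rightarrow> ((real ^ 'm) \<times> 'u \<Rightarrow> real) \<Rightarrow> real" where
  "time_average f y0 u T q = 1 / T * (LINT t:{0..T}|lebesgue. q (trajectory f y0 u t, u t))"

definition discounted_average ::
  "((real ^ 'm) \<times> 'u \<Rightarrow> real ^ 'm) \<Rightarrow> real ^ 'm \<Rightarrow> (real \<Rightarrow> 'u) \<Rightarrow> real
    \<Rightarrow> ((real ^ 'm) \<times> 'u \<Rightarrow> real) \<Rightarrow> real" where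
  "discounted_average f y0 u lam q =
    lam * (LINT t:{0..}|lebesgue. exp (- lam * t) * q (trajectory f y0 u t, u t))"

text \<open>
  Optimal values are extended reals, so that an infimum over the empty set is \<open>\<infinity>\<close>.
\<close>

definition v_T ::
  "((real ^ 'm) \<times> 'u::metric_space \<Rightarrow> real ^ 'm) \<Rightarrow> ((real ^ 'm) \<times> 'u \<Rightarrow> real) \<Rightarrow> 'u set
    \<Rightarrow> (real ^ 'm) set \<Rightarrow> real ^ 'm \<Rightarrow> real \<Rightarrow> ereal" where
  "v_T f k U Y y0 T = ereal (1 / T) *
    (INF u\<in>admissible_upto f U Y y0 T.
      ereal (LINT t:{0..T}|lebesgue. k (trajectory f y0 u t, u t)))"

definition h_disc ::
  "((real ^ 'm) \<times> 'u::metric_space \<Rightarrow> real ^ 'm) \<Rightarrow> ((real ^ 'm) \<times> 'u \<Rightarrow> real) \<Rightarrow> 'u set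
    \<Rightarrow> (real ^ 'm) set \<Rightarrow> real ^ 'm \<Rightarrow> real \<Rightarrow> ereal" where
  "h_disc f k U Y y0 lam = ereal lam *
    (INF u\<in>admissible f U Y y0.
      ereal (LINT t:{0..}|lebesgue. exp (- lam * t) * k (trajectory f y0 u t, u t)))"

subsection \<open>Measures on a subset of a topological space\<close>

definition finite_borel_measures :: "('a::topological_space) set \<Rightarrow> 'a measure set" where
  "finite_borel_measures S = {\<xi>. sets \<xi> = sets (restrict_space borel S) \<and> finite_measure \<xi>}"

definition prob_borel_measures :: "('a::topological_space) set \<Rightarrow> 'a measure set" where
  "prob_borel_measures S = {\<gamma>. sets \<gamma> = sets (restrict_space borel S) \<and> prob_space \<gamma>}"

definition weak_star_lim ::
  "('a::topological_space) set \<Rightarrow> (nat \<Rightarrow> 'a measure) \<Rightarrow> 'a measure \<Rightarrow> bool" where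
  "weak_star_lim S \<gamma>s \<gamma> \<longleftrightarrow>
    (\<forall>q::'a \<Rightarrow> real. continuous_on S q \<longrightarrow>
      (\<lambda>l. integral\<^sup>L (\<gamma>s l) q) \<longlonglongrightarrow> integral\<^sup>L \<gamma> q)"

definition Gamma_T ::
  "((real ^ 'm) \<times> 'u::metric_space \<Rightarrow> real ^ 'm) \<Rightarrow> 'u set \<Rightarrow> (real ^ 'm) set \<Rightarrow> real ^ 'm
    \<Rightarrow> real \<Rightarrow> ((real ^ 'm) \<times> 'u) measure set" where
  "Gamma_T f U Y y0 T =
    {\<gamma> \<in> prob_borel_measures (Y \<times> U). \<exists>u\<in>admissible_upto f U Y y0 T.
      \<forall>q. continuous_on (Y \<times> U) q \<longrightarrow> integral\<^sup>L \<gamma> q = time_average f y0 u T q}"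

definition Theta ::
  "((real ^ 'm) \<times> 'u::metric_space \<Rightarrow> real ^ 'm) \<Rightarrow> 'u set \<Rightarrow> (real ^ 'm) set \<Rightarrow> real ^ 'm
    \<Rightarrow> real \<Rightarrow> ((real ^ 'm) \<times> 'u) measure set" where
  "Theta f U Y y0 lam =
    {\<gamma> \<in> prob_borel_measures (Y \<times> U). \<exists>u\<in>admissible f U Y y0.
      \<forall>q. continuous_on (Y \<times> U) q \<longrightarrow> integral\<^sup>L \<gamma> q = discounted_average f y0 u lam q}"

definition limsup_measures ::
  "('a::topological_space) set \<Rightarrow> real filter \<Rightarrow> (real \<Rightarrow> 'a measure set) \<Rightarrow> 'a measure set" where
  "limsup_measures S F G =
    {\<gamma> \<in> prob_borel_measures S. \<exists>p \<gamma>s. filterlim p F sequentially \<and>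
      (\<forall>l::nat. 0 < p l \<and> \<gamma>s l \<in> G (p l)) \<and> weak_star_lim S \<gamma>s \<gamma>}"

subsection \<open>The limit set \<open>W\<^sub>2(y\<^sub>0)\<close> and the dual value\<close>

definition W ::
  "((real ^ 'm) \<times> 'u::metric_space \<Rightarrow> real ^ 'm) \<Rightarrow> 'u set \<Rightarrow> (real ^ 'm) set
    \<Rightarrow> ((real ^ 'm) \<times> 'u) measure set" where
  "W f U Y =
    {\<gamma> \<in> prob_borel_measures (Y \<times> U). \<forall>\<phi>\<in>C1. (\<integral>(y, u). grad \<phi> y \<bullet> f (y, u) \<partial>\<gamma>) = 0}"

definition W\<^sub>2 ::
  "((real ^ 'm) \<times> 'u::metric_space \<Rightarrow> real ^ 'm) \<Rightarrow> 'u set \<Rightarrow> (real ^ 'm) set \<Rightarrow> real ^ 'm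
    \<Rightarrow> ((real ^ 'm) \<times> 'u) measure set" where
  "W\<^sub>2 f U Y y0 =
    {\<gamma> \<in> W f U Y. \<exists>\<xi>::nat \<Rightarrow> _. (\<forall>l. \<xi> l \<in> finite_borel_measures (Y \<times> U)) \<and>
      (\<forall>\<phi>\<in>C1. (\<lambda>l. \<integral>(y, u). grad \<phi> y \<bullet> f (y, u) \<partial>\<xi> l)
                 \<longlonglongrightarrow> (\<integral>(y, u). \<phi> y - \<phi> y0 \<partial>\<gamma>))}"

definition d_star ::
  "((real ^ 'm) \<times> 'u::metric_space \<Rightarrow> real ^ 'm) \<Rightarrow> ((real ^ 'm) \<times> 'u \<Rightarrow> real) \<Rightarrow> 'u set
    \<Rightarrow> (real ^ 'm) set \<Rightarrow> real ^ 'm \<Rightarrow> ereal" where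
  "d_star f k U Y y0 =
    Sup {ereal \<mu> | \<mu> \<psi> \<eta>. \<psi> \<in> C1 \<and> \<eta> \<in> C1 \<and>
      (\<forall>y\<in>Y. \<forall>u\<in>U.
        k (y, u) + (\<psi> y0 - \<psi> y) + grad \<eta> y \<bullet> f (y, u) - \<mu> \<ge> 0 \<and>
        grad \<psi> y \<bullet> f (y, u) \<ge> 0)}"

end

theory Submission
  imports Defs
begin

text \<open>
  Along a trajectory \<open>y\<close> that stays in the compact set \<open>Y\<close>, every test function satisfies
  \<open>\<phi> (y T) - \<phi> y0 = \<integral>\<^sub>0\<^sup>T \<nabla>\<phi> \<bullet> f\<close>.  Everything follows from weighted versions of this identity
  (lemma \<open>weighted_balance\<close>), in which the left-hand side is bounded because \<open>\<phi>\<close> is bounded on \<open>Y\<close>.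

  With weight \<open>1\<close>, dividing by \<open>T\<close> shows that the occupational measures are stationary up to
  \<open>O(1 / T)\<close>.  With weight \<open>1 - t / T\<close> it shows that the integral of \<open>\<phi> y - \<phi> y0\<close> against an
  occupational measure equals the integral of \<open>\<nabla>\<phi> \<bullet> f\<close> against the occupational measure that weights
  time by \<open>1 - t / T\<close>.  This holds before any limit is taken, so these weighted measures
  are the sequence \<open>\<xi>\<close> required by \<open>W\<^sub>2\<close>.  With weight \<open>exp (- lam * t)\<close> it gives
  \<open>\<integral> \<nabla>\<phi> \<bullet> f d\<gamma> = lam * \<integral> (\<phi> y - \<phi> y0) d\<gamma>\<close> for each discounted measure \<open>\<gamma>\<close>: it is stationary up to
  \<open>O(lam)\<close>, and the multiple \<open>\<gamma> / lam\<close> plays the role of \<open>\<xi>\<close>.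

  The bounds on the values are weak duality carried out along each single trajectory (lemmas
  \<open>average_cost_ge\<close> and \<open>discounted_cost_ge\<close>): the term with \<open>\<psi>\<close> has the right sign and the term
  with \<open>\<eta>\<close> reduces to increments of \<open>\<eta>\<close>, which are bounded on \<open>Y\<close>, so a triplet \<open>(\<mu>, \<psi>, \<eta>)\<close> bounds the value from below by
  \<open>\<mu> - O(1 / T)\<close>, respectively \<open>\<mu> - O(lam)\<close>.

  Two facts about the control system underlie these identities: trajectories exist for all time
  (lemma \<open>solution_exists\<close>), and the chain rule holds along curves that are only indefinite integrals of
  bounded measurable functions (lemma \<open>chain_rule_integral_curve\<close>).
\<close>

section \<open>The chain rule along integral curves\<close>

lemma indefinite_integral_increment_le:
  fixes g :: "real \<Rightarrow> 'a::euclidean_space"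
  assumes g: "g integrable_on {0..T}" and ab: "a \<in> {0..T}" "b \<in> {0..T}" and "0 \<le> B"
    and bd: "\<And>s. s \<in> {0..T} \<Longrightarrow> \<bar>s - a\<bar> \<le> \<bar>b - a\<bar> \<Longrightarrow> norm (g s) \<le> B"
  shows "norm (integral {0..b} g - integral {0..a} g) \<le> B * \<bar>b - a\<bar>"
proof -
  have aux: "norm (integral {0..d} g - integral {0..c} g) \<le> B * (d - c)"
    if "0 \<le> c" "c \<le> d" "d \<le> T" and bd': "\<And>s. s \<in> {c..d} \<Longrightarrow> norm (g s) \<le> B" for c d
  proof -
    have "g integrable_on {0..d}" "g integrable_on {c..d}"
      using integrable_on_subinterval[OF g] that by auto
    then have "integral {0..d} g - integral {0..c} g = integral {c..d} g"
      using Henstock_Kurzweil_Integration.integral_combine[of 0 c d g] that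
      by (simp add: algebra_simps)
    moreover have "(g has_integral integral {c..d} g) (cbox c d)"
      using \<open>g integrable_on {c..d}\<close> by (simp add: has_integral_integral)
    then have "norm (integral {c..d} g) \<le> B * Henstock_Kurzweil_Integration.content (cbox c d)"
      by (rule has_integral_bound[OF \<open>0 \<le> B\<close>]) (use bd' in auto)
    ultimately show ?thesis
      using \<open>c \<le> d\<close> by simp
  qed
  show ?thesis
  proof (cases "a \<le> b")
    case True
    then show ?thesis using aux[of a b] bd ab by auto
  next
    case False
    then show ?thesis using aux[of b a] bd ab by (auto simp: norm_minus_commute)
  qed
qed

text \<open>
  The curve \<open>x\<close> is merely an indefinite integral, so it need not have a derivative at any particular
  point.  Still, near each \<open>a\<close> both \<open>F \<circ> x\<close> and the indefinite integral of \<open>D \<bullet> w\<close> change by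
  \<open>D a \<bullet> (x b - x a) + o(\<bar>b - a\<bar>)\<close>: the first because \<open>F\<close> is differentiable and \<open>x\<close> is Lipschitz,
  the second because \<open>D\<close> is continuous and \<open>w\<close> is bounded.  Hence their difference has derivative
  zero everywhere and is constant.  This gives a fundamental theorem of calculus for Caratheodory
  solutions without differentiating integrals almost everywhere.
\<close>

lemma chain_rule_integral_curve:
  fixes x w :: "real \<Rightarrow> 'a::euclidean_space" and F :: "'a \<Rightarrow> real"
  assumes "0 \<le> T"
    and meas: "w \<in> borel_measurable (lebesgue_on {0..T})"
    and bd: "\<And>t. t \<in> {0..T} \<Longrightarrow> norm (w t) \<le> M"
    and int: "\<And>t. t \<in> {0..T} \<Longrightarrow> (w has_integral (x t - x 0)) {0..t}"
    and der: "\<And>t. t \<in> {0..T} \<Longrightarrow> GDERIV F (x t) :> D t"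
    and cont: "continuous_on {0..T} D"
  shows "((\<lambda>t. D t \<bullet> w t) has_integral (F (x T) - F (x 0))) {0..T}"
proof -
  let ?I = "{0..T}"
  have M0: "0 \<le> M"
    using bd[of 0] \<open>0 \<le> T\<close> norm_ge_zero[of "w 0"] by (simp del: norm_ge_zero)
  have w_ab: "w absolutely_integrable_on ?I"
    by (rule measurable_bounded_by_integrable_imp_absolutely_integrable[where g = "\<lambda>_. M"])
      (use meas bd in auto)
  have prod_ab: "(\<lambda>t. E t \<bullet> w t) absolutely_integrable_on ?I" if "continuous_on ?I E" for E
  proof (rule absolutely_integrable_bounded_measurable_product[where h = "(\<bullet>)", OF _ _ _ _ w_ab])
    show "bilinear ((\<bullet>) :: 'a \<Rightarrow> 'a \<Rightarrow> real)"
      by (simp add: bilinear_conv_bounded_bilinear bounded_bilinear_inner)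
    show "E \<in> borel_measurable (lebesgue_on ?I)"
      by (intro continuous_imp_measurable_on_sets_lebesgue that) auto
    show "bounded (E ` ?I)"
      by (intro compact_imp_bounded compact_continuous_image that) auto
  qed auto
  \<comment> \<open>Bounded velocity makes the curve Lipschitz.\<close>
  have lip: "norm (x b - x a) \<le> M * \<bar>b - a\<bar>" if "a \<in> ?I" "b \<in> ?I" for a b
  proof -
    have "x b - x a = integral {0..b} w - integral {0..a} w"
      using int[OF that(1)] int[OF that(2)] by (simp add: integral_unique)
    then show ?thesis
      using indefinite_integral_increment_le[OF _ that M0, of w] bd w_ab
      by (simp add: set_lebesgue_integral_eq_integral(1))
  qed
  define G where "G = (\<lambda>t. F (x t) - integral {0..t} (\<lambda>s. D s \<bullet> w s))"
  have "(G has_derivative (\<lambda>h. 0)) (at a within ?I)" if a: "a \<in> ?I" for a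
    unfolding has_derivative_within_alt
  proof (intro conjI allI impI)
    fix e :: real assume "e > 0"
    \<comment> \<open>The increments of the two parts of \<open>G\<close> contribute one error \<open>e' * M\<close> each.\<close>
    define e' where "e' = e / (2 * (M + 1))"
    have e': "e' > 0" "2 * (e' * M) \<le> e"
      using \<open>e > 0\<close> M0 by (auto simp: e'_def field_simps)
    have "(F has_derivative (\<lambda>h. h \<bullet> D a)) (at (x a) within UNIV)"
      using der[OF a] by (simp add: gderiv_def)
    then obtain d1 where d1: "d1 > 0"
      "\<And>z. norm (z - x a) < d1 \<Longrightarrow> norm (F z - F (x a) - (z - x a) \<bullet> D a) \<le> e' * norm (z - x a)"
      using e'(1) unfolding has_derivative_within_alt by blast
    obtain d2 where d2: "d2 > 0"
      "\<And>s. s \<in> ?I \<Longrightarrow> dist s a < d2 \<Longrightarrow> dist (D s) (D a) < e'"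
      using cont a e'(1) unfolding continuous_on_iff by blast
    show "\<exists>d>0. \<forall>b\<in>?I. norm (b - a) < d \<longrightarrow> norm (G b - G a - 0) \<le> e * norm (b - a)"
    proof (intro exI[of _ "min (d1 / (M + 1)) d2"] conjI ballI impI)
      show "min (d1 / (M + 1)) d2 > 0" using d1 d2 M0 by simp
      fix b assume b: "b \<in> ?I" and ba: "norm (b - a) < min (d1 / (M + 1)) d2"
      have "M * \<bar>b - a\<bar> \<le> (M + 1) * \<bar>b - a\<bar>" by (simp add: mult_right_mono)
      also have "\<dots> < d1" using ba M0 by (simp add: field_simps)
      finally have "norm (x b - x a) < d1" using lip[OF a b] by linarith
      from d1(2)[OF this]
      have 1: "\<bar>F (x b) - F (x a) - (x b - x a) \<bullet> D a\<bar> \<le> e' * M * \<bar>b - a\<bar>"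
        using mult_left_mono[OF lip[OF a b] less_imp_le[OF e'(1)]] unfolding real_norm_def mult.assoc
        by (rule order_trans)
      let ?h = "\<lambda>s. (D s - D a) \<bullet> w s"
      have h: "?h integrable_on ?I"
        by (rule set_lebesgue_integral_eq_integral(1)[OF prod_ab])
          (intro continuous_intros cont)
      have 2: "norm (integral {0..b} ?h - integral {0..a} ?h) \<le> e' * M * \<bar>b - a\<bar>"
      proof (rule indefinite_integral_increment_le[OF h a b])
        fix s assume s: "s \<in> ?I" "\<bar>s - a\<bar> \<le> \<bar>b - a\<bar>"
        have "norm (?h s) \<le> norm (D s - D a) * norm (w s)"
          by (simp add: Cauchy_Schwarz_ineq2)
        also have "\<dots> \<le> e' * M"
          using d2(2)[OF s(1)] s(2) ba bd[OF s(1)] e'(1)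
          by (intro mult_mono) (auto simp: dist_norm)
        finally show "norm (?h s) \<le> e' * M" .
      qed (use e' M0 in auto)
      have split_h: "integral {0..t} ?h
          = integral {0..t} (\<lambda>s. D s \<bullet> w s) - D a \<bullet> (x t - x 0)" if "t \<in> ?I" for t
      proof -
        have "(\<lambda>s. D s \<bullet> w s) integrable_on {0..t}"
          using integrable_on_subinterval[OF set_lebesgue_integral_eq_integral(1)[OF prod_ab[OF cont]]]
            that by auto
        moreover have "((\<lambda>s. D a \<bullet> w s) has_integral (D a \<bullet> (x t - x 0))) {0..t}"
          using has_integral_linear[OF int[OF that] bounded_linear_inner_right[of "D a"]]
          by (simp add: o_def)
        ultimately show ?thesis
          by (simp add: inner_diff_left integral_diff has_integral_integrable integral_unique)
      qed
      have "G b - G a = (F (x b) - F (x a) - (x b - x a) \<bullet> D a)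
          - (integral {0..b} ?h - integral {0..a} ?h)"
        unfolding split_h[OF a] split_h[OF b] G_def
        by (simp add: inner_diff_left inner_diff_right inner_commute algebra_simps)
      then have "\<bar>G b - G a\<bar> \<le> 2 * (e' * M) * \<bar>b - a\<bar>"
        using 1 2 unfolding real_norm_def by linarith
      also have "\<dots> \<le> e * \<bar>b - a\<bar>" using e'(2) by (rule mult_right_mono) simp
      finally show "norm (G b - G a - 0) \<le> e * norm (b - a)" by simp
    qed
  qed simp
  from has_derivative_zero_constant[OF convex_real_interval(5)[of 0 T] this]
  have "G T = G 0" using \<open>0 \<le> T\<close> by fastforce
  then have "integral ?I (\<lambda>s. D s \<bullet> w s) = F (x T) - F (x 0)"
    by (simp add: G_def)
  then show ?thesis
    using set_lebesgue_integral_eq_integral(1)[OF prod_ab[OF cont]]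
    by (metis integrable_integral)
qed

section \<open>Measurability of state-control pairs\<close>

lemma control_in_set: "u \<in> controls U \<Longrightarrow> 0 \<le> t \<Longrightarrow> u t \<in> U"
  using measurable_space[of u "lebesgue_on {0..}" "restrict_space borel U" t]
  by (auto simp: controls_def space_restrict_space)

text \<open>
  The control space need not be second countable, so the Borel sets of the product are not
  generated by rectangles and measurability of the components alone does not suffice.  Freezing the state
  on the cells of a grid of mesh \<open>1 / Suc n\<close> gives countably many continuous images of the
  measurable control glued together; continuity of \<open>y\<close> then makes the pair a pointwise limit of
  such functions.
\<close>

lemma state_control_measurable:
  fixes y :: "real \<Rightarrow> real ^ 'm" and u :: "real \<Rightarrow> 'u::metric_space"
  assumes y: "continuous_on {0..} y" and u: "u \<in> controls U"
    and J: "J \<subseteq> {0..}" and S: "\<And>t. t \<in> J \<Longrightarrow> y t \<in> S"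
  shows "(\<lambda>t. (y t, u t)) \<in> lebesgue_on J \<rightarrow>\<^sub>M restrict_space borel (S \<times> U)"
proof -
  let ?L = "lebesgue_on {0::real..}"
  have u': "u \<in> borel_measurable ?L"
    using u by (simp add: controls_def measurable_restrict_space2_iff)
  define r where "r = (\<lambda>(n::nat) (t::real). real (nat \<lfloor>real (Suc n) * t\<rfloor>) / real (Suc n))"
  have "(\<lambda>t. (y t, u t)) \<in> borel_measurable ?L"
  proof (rule borel_measurable_LIMSEQ_metric[where f = "\<lambda>n t. (y (r n t), u t)"])
    fix n
    have pair: "(\<lambda>t. (c, u t)) \<in> borel_measurable ?L" for c :: "real ^ 'm"
      by (rule measurable_compose[OF u' borel_measurable_continuous_onI]) (intro continuous_intros)
    have "(\<lambda>t. nat \<lfloor>real (Suc n) * t\<rfloor>) \<in> ?L \<rightarrow>\<^sub>M count_space UNIV"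
      by (rule measurable_restrict_space1, rule measurable_completion) measurable
    then show "(\<lambda>t. (y (r n t), u t)) \<in> borel_measurable ?L"
      unfolding r_def
      by (rule measurable_compose_countable[where f = "\<lambda>i t. (y (real i / real (Suc n)), u t)", OF pair])
  next
    fix t assume "t \<in> space ?L"
    then have t: "0 \<le> t" by simp
    have "(\<lambda>n. r n t) \<longlonglongrightarrow> t"
    proof (rule real_tendsto_sandwich)
      have floor_le: "real (nat \<lfloor>c\<rfloor>) \<le> c \<and> c < real (nat \<lfloor>c\<rfloor>) + 1" if "0 \<le> c" for c :: real
        using that by simp
      have "t - 1 / real (Suc n) \<le> r n t \<and> r n t \<le> t" for n
      proof -
        let ?N = "real (Suc n)" and ?F = "real (nat \<lfloor>real (Suc n) * t\<rfloor>)"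
        have *: "?F \<le> ?N * t \<and> ?N * t < ?F + 1"
          by (rule floor_le) (use t in simp)
        have "t - 1 / ?N = (?N * t - 1) / ?N" by (simp add: field_simps del: of_nat_Suc)
        also have "\<dots> \<le> ?F / ?N" using * by (intro divide_right_mono) auto
        finally show ?thesis
          using * by (simp add: r_def pos_divide_le_eq mult.commute del: of_nat_Suc)
      qed
      then show "\<forall>\<^sub>F n in sequentially. t - 1 / real (Suc n) \<le> r n t"
        "\<forall>\<^sub>F n in sequentially. r n t \<le> t"
        by auto
      show "(\<lambda>n. t - 1 / real (Suc n)) \<longlonglongrightarrow> t"
        using tendsto_diff[OF tendsto_const LIMSEQ_inverse_real_of_nat, of t]
        by (simp add: inverse_eq_divide)
    qed simp
    then have "(\<lambda>n. y (r n t)) \<longlonglongrightarrow> y t"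
      by (rule continuous_on_tendsto_compose[OF y]) (use t in \<open>auto simp: r_def\<close>)
    then show "(\<lambda>n. (y (r n t), u t)) \<longlonglongrightarrow> (y t, u t)"
      by (intro tendsto_Pair tendsto_const)
  qed
  then have "(\<lambda>t. (y t, u t)) \<in> borel_measurable (lebesgue_on J)"
    by (rule measurable_restrict_mono[OF _ J])
  then show ?thesis
    using S J control_in_set[OF u] by (intro measurable_restrict_space2) auto
qed

lemma observable_measurable:
  fixes y :: "real \<Rightarrow> real ^ 'm" and q :: "(real ^ 'm) \<times> 'u::metric_space \<Rightarrow> 'b::topological_space"
  assumes "continuous_on {0..} y" "u \<in> controls U" "J \<subseteq> {0..}" "\<And>t. t \<in> J \<Longrightarrow> y t \<in> S"
    and q: "continuous_on (S \<times> U) q"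
  shows "(\<lambda>t. q (y t, u t)) \<in> borel_measurable (lebesgue_on J)"
  by (rule measurable_compose[OF state_control_measurable[OF assms(1-4)]
        borel_measurable_continuous_on_restrict[OF q]])

section \<open>Existence of Caratheodory solutions\<close>

lemma continuous_on_indefinite_integral_atLeast:
  fixes g :: "real \<Rightarrow> 'a::banach"
  assumes g: "\<And>t. g integrable_on {0..t}"
  shows "continuous_on {0..} (\<lambda>t. integral {0..t} g)"
  unfolding continuous_on_eq_continuous_within
proof
  fix t :: real assume "t \<in> {0..}"
  have "continuous_on {0..t + 1} (\<lambda>t. integral {0..t} g)"
    by (rule indefinite_integral_continuous_1[OF g])
  then have "continuous (at t within {0..t + 1}) (\<lambda>t. integral {0..t} g)"
    using \<open>t \<in> {0..}\<close> by (simp add: continuous_on_eq_continuous_within)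
  moreover have "at t within {0..t + 1} = at t within {0..}"
    by (rule at_within_nhd[of _ "{..<t + 1}"]) auto
  ultimately show "continuous (at t within {0..}) (\<lambda>t. integral {0..t} g)"
    by (simp add: continuous_within)
qed

text \<open>
  This estimate makes the integral operator of the differential equation bounded, and for the weight
  \<open>K = 2 * (L + 1)\<close> contracting, in the exponentially weighted supremum norm.
\<close>

lemma weighted_integral_bound:
  fixes h :: "real \<Rightarrow> 'a::euclidean_space"
  assumes h: "h integrable_on {0..t}" and "0 \<le> C" "0 < K"
    and bd: "\<And>s. s \<in> {0..t} \<Longrightarrow> norm (h s) \<le> C * exp (K * s)"
  shows "norm (exp (- K * t) *\<^sub>R integral {0..t} h) \<le> C / K"
proof (cases "0 \<le> t")
  case True
  have "((\<lambda>s. C * exp (K * s)) has_integral (C * exp (K * t) / K - C * exp (K * 0) / K)) {0..t}"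
    by (rule fundamental_theorem_of_calculus[OF True])
      (use \<open>0 < K\<close> in \<open>auto intro!: derivative_eq_intros simp flip: has_real_derivative_iff_has_vector_derivative\<close>)
  from integral_norm_bound_integral[OF h has_integral_integrable[OF this] bd] integral_unique[OF this]
  have "norm (integral {0..t} h) \<le> C * exp (K * t) / K - C / K" by simp
  also have "\<dots> \<le> C * exp (K * t) / K" using assms by simp
  finally have "norm (exp (- K * t) *\<^sub>R integral {0..t} h) \<le> exp (- K * t) * (C * exp (K * t) / K)"
    by (simp del: times_divide_eq_right add: mult_left_mono)
  also have "\<dots> = C / K" by (simp add: exp_minus field_simps)
  finally show ?thesis .
qed (use assms in simp)

text \<open>
  Picard's theorem in the Caratheodory sense, on the whole half-line at once.  The unknown is the
  rescaled displacement \<open>z t = exp (- K * t) *\<^sub>R (y t - y0)\<close>, sought among bounded continuous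
  functions.  In this norm the integral operator \<open>Q\<close> maps the space to itself and has Lipschitz
  constant \<open>L / K \<le> 1 / 2\<close>, so Banach's fixed point theorem applies without restricting time.
  Since \<open>trajectory\<close> is given by a choice operator, existence is what makes it a solution.
\<close>

lemma solution_exists:
  fixes f :: "(real ^ 'm) \<times> 'u::metric_space \<Rightarrow> real ^ 'm"
  assumes "compact U" and f: "continuous_on (UNIV \<times> U) f"
    and lip: "\<And>v. v \<in> U \<Longrightarrow> L-lipschitz_on UNIV (\<lambda>y. f (y, v))"
    and u: "u \<in> controls U"
  shows "\<exists>y. is_solution f y0 u y"
proof -
  have "u 0 \<in> U" using control_in_set[OF u] by simp
  then have L0: "0 \<le> L" using lip lipschitz_on_nonneg by blast
  define K where "K = 2 * (L + 1)"
  have K0: "0 < K" using L0 by (simp add: K_def)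
  have "continuous_on U (\<lambda>v. f (y0, v))"
    by (rule continuous_on_compose2[OF f]) (auto intro!: continuous_intros)
  then have "bounded ((\<lambda>v. f (y0, v)) ` U)"
    using \<open>compact U\<close> by (intro compact_imp_bounded compact_continuous_image)
  then obtain M where M: "\<And>v. v \<in> U \<Longrightarrow> norm (f (y0, v)) \<le> M"
    unfolding bounded_iff by blast
  have M0: "0 \<le> M" using M[OF \<open>u 0 \<in> U\<close>] norm_ge_zero order_trans by blast
  define X where "X = (\<lambda>(z::real \<Rightarrow>\<^sub>C (real ^ 'm)) s. y0 + exp (K * s) *\<^sub>R z s)"
  define g where "g = (\<lambda>z s. f (X z s, u s))"
  have contX: "continuous_on A (X z)" for z A
    unfolding X_def by (intro continuous_intros continuous_on_apply_bcontfun)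
  have g_meas: "g z \<in> borel_measurable (lebesgue_on {0..t})" for z t
    unfolding g_def
    by (rule observable_measurable[OF contX u _ _ f]) auto
  have g_diff: "norm (f (X z s, u s) - f (c, u s)) \<le> L * norm (X z s - c)" if "0 \<le> s" for z s c
    using lipschitz_onD[OF lip[OF control_in_set[OF u that]], of "X z s" c] by (simp add: dist_norm)
  have g_bd: "norm (g z s) \<le> (M + L * norm z) * exp (K * s)" if "0 \<le> s" for z s
  proof -
    have "norm (g z s) \<le> norm (f (y0, u s)) + norm (f (X z s, u s) - f (y0, u s))"
      unfolding g_def by norm
    also have "\<dots> \<le> M + L * norm (X z s - y0)"
      using M[OF control_in_set[OF u that]] g_diff[OF that] by (intro add_mono)
    also have "\<dots> \<le> M * exp (K * s) + L * (norm z * exp (K * s))"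
      using M0 L0 K0 that norm_bounded[of z s]
      by (intro add_mono mult_left_mono) (auto simp: X_def mult.commute intro!: mult_right_mono mult_le_cancel_left1[THEN iffD2])
    finally show ?thesis by (simp add: algebra_simps)
  qed
  have g_ab: "g z absolutely_integrable_on {0..t}" for z t
    by (rule measurable_bounded_by_integrable_imp_absolutely_integrable
        [where g = "\<lambda>s. (M + L * norm z) * exp (K * s)"])
      (use g_meas g_bd in \<open>auto intro!: integrable_continuous_real continuous_intros\<close>)
  note g_int = set_lebesgue_integral_eq_integral[OF g_ab]
  define Q where "Q = (\<lambda>z t. exp (- K * t) *\<^sub>R integral {0..t} (g z))"
  have Q_bd: "norm (Q z t) \<le> (M + L * norm z) / K" for z t
    unfolding Q_def
    by (rule weighted_integral_bound[OF g_int(1)]) (use M0 L0 K0 g_bd in auto)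
  have "continuous_on UNIV (\<lambda>t. integral {0..t} (g z))" for z
  proof -
    \<comment> \<open>For negative \<open>t\<close> the interval is empty and the integral is \<open>0\<close>, so \<open>Q z\<close> is
      continuous on all of the reals as soon as it is so on \<open>{0..}\<close>.\<close>
    have "(\<lambda>t. integral {0..t} (g z)) = (\<lambda>t. integral {0..max 0 t} (g z))"
      by (auto simp: max_def)
    moreover have "continuous_on UNIV (\<lambda>t. integral {0..max 0 t} (g z))"
      by (rule continuous_on_compose2[OF continuous_on_indefinite_integral_atLeast[OF g_int(1)]])
        (auto intro!: continuous_intros)
    ultimately show ?thesis by metis
  qed
  then have "continuous_on UNIV (Q z)" for z
    unfolding Q_def by (intro continuous_intros) auto
  then have Q_bc: "Q z \<in> bcontfun" for z
    using Q_bd by (rule bcontfun_normI)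
  define P where "P = (\<lambda>z. Bcontfun (Q z))"
  have P: "apply_bcontfun (P z) = Q z" for z
    unfolding P_def by (rule Bcontfun_inverse[OF Q_bc])
  have "dist (P z) (P z') \<le> 1 / 2 * dist z z'" for z z'
  proof (rule dist_bound)
    fix t
    have "norm (exp (- K * t) *\<^sub>R integral {0..t} (\<lambda>s. g z s - g z' s)) \<le> (L * dist z z') / K"
    proof (rule weighted_integral_bound)
      fix s assume "s \<in> {0..t}"
      then have "norm (g z s - g z' s) \<le> L * norm (X z s - X z' s)"
        using g_diff by (simp add: g_def)
      also have "X z s - X z' s = exp (K * s) *\<^sub>R (z s - z' s)"
        by (simp add: X_def scaleR_diff_right)
      also have "L * norm (exp (K * s) *\<^sub>R (z s - z' s)) \<le> L * (exp (K * s) * dist z z')"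
        using L0 dist_bounded[of z s z'] by (intro mult_left_mono) (auto simp: dist_norm)
      finally show "norm (g z s - g z' s) \<le> L * dist z z' * exp (K * s)"
        by (simp add: algebra_simps)
    qed (use g_int(1) L0 K0 in \<open>auto intro: integrable_diff\<close>)
    also have "integral {0..t} (\<lambda>s. g z s - g z' s) = integral {0..t} (g z) - integral {0..t} (g z')"
      by (intro integral_diff g_int(1))
    finally have "dist (Q z t) (Q z' t) \<le> L / K * dist z z'"
      by (simp add: Q_def dist_norm scaleR_diff_right)
    also have "\<dots> \<le> 1 / 2 * dist z z'"
      using L0 by (intro mult_right_mono) (auto simp: K_def field_simps)
    finally show "dist (P z t) (P z' t) \<le> 1 / 2 * dist z z'" by (simp add: P)
  qed
  then obtain z where "P z = z"
    using banach_fix_type[of "1 / 2" P] by auto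
  then have "Q z = apply_bcontfun z" using P by metis
  then have fixpoint: "X z t = y0 + integral {0..t} (g z)" for t
    unfolding X_def by (simp add: Q_def fun_eq_iff exp_minus flip: \<open>Q z = apply_bcontfun z\<close>)
  have "is_solution f y0 u (X z)"
    unfolding is_solution_def
  proof (intro allI impI conjI)
    fix t :: real
    show "set_integrable lebesgue {0..t} (\<lambda>s. f (X z s, u s))"
      using g_ab by (simp add: g_def)
    show "X z t = y0 + (LINT s:{0..t}|lebesgue. f (X z s, u s))"
      using fixpoint[of t] g_int(2) by (simp add: g_def)
  qed
  then show ?thesis by (intro exI[of _ "X z"])
qed

section \<open>Test functions and their gradients\<close>

text \<open>
  The definite description in \<open>grad\<close> denotes the gradient: a linear functional on a Euclidean
  space is represented by the value of its adjoint at \<open>1\<close>, and the representing vector is unique.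
\<close>

lemma C1_gderiv:
  fixes \<phi> :: "real ^ 'm \<Rightarrow> real"
  assumes "\<phi> \<in> C1"
  shows "GDERIV \<phi> y :> grad \<phi> y"
proof -
  obtain F' where F': "(\<phi> has_derivative F') (at y)"
    using assms by (auto simp: C1_def differentiable_def)
  have bl: "bounded_linear F'" using F' by (rule has_derivative_bounded_linear)
  define D where "D = adjoint F' 1"
  have "F' h = h \<bullet> D" for h
    using adjoint_works[OF bounded_linear.linear[OF bl], of h "1::real"] unfolding D_def by simp
  then have F'_eq: "F' = (\<lambda>h. h \<bullet> D)" by (rule ext)
  have D: "GDERIV \<phi> y :> D"
    using F' unfolding gderiv_def F'_eq .
  moreover have "D' = D" if "GDERIV \<phi> y :> D'" for D'
  proof -
    have "(\<lambda>h. h \<bullet> D') = (\<lambda>h. h \<bullet> D)"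
      using that D unfolding gderiv_def by (rule has_derivative_unique)
    then show ?thesis by (metis vector_eq_ldot)
  qed
  ultimately show ?thesis
    unfolding grad_def by (rule theI[where P = "\<lambda>D. GDERIV \<phi> y :> D"])
qed

lemma C1_continuous:
  fixes \<phi> :: "real ^ 'm \<Rightarrow> real"
  assumes "\<phi> \<in> C1"
  shows "continuous_on A \<phi>"
proof (intro continuous_at_imp_continuous_on ballI)
  fix y
  show "isCont \<phi> y"
    using C1_gderiv[OF assms, of y] unfolding gderiv_def by (rule has_derivative_continuous)
qed

lemma C1_grad_continuous:
  fixes \<phi> :: "real ^ 'm \<Rightarrow> real"
  assumes "\<phi> \<in> C1"
  shows "continuous_on A (grad \<phi>)"
proof (rule continuous_on_subset)
  show "continuous_on UNIV (grad \<phi>)"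
    using assms unfolding C1_def by blast
qed simp

lemma grad_f_continuous:
  fixes f :: "(real ^ 'm) \<times> 'u::topological_space \<Rightarrow> real ^ 'm"
  assumes f: "continuous_on (Y \<times> U) f" and "\<phi> \<in> C1"
  shows "continuous_on (Y \<times> U) (\<lambda>(y, v). grad \<phi> y \<bullet> f (y, v))"
  unfolding case_prod_unfold prod.collapse
  by (intro continuous_on_inner f continuous_on_compose2[OF C1_grad_continuous[OF \<open>\<phi> \<in> C1\<close>, of UNIV]]
      continuous_on_fst continuous_on_id) auto

lemma increment_continuous:
  assumes "\<phi> \<in> C1"
  shows "continuous_on (Y \<times> U) (\<lambda>(y, v). \<phi> y - \<phi> y0)"
  unfolding case_prod_unfold
  by (intro continuous_on_diff continuous_on_const continuous_on_compose2[OF C1_continuous[OF assms, of UNIV]]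
      continuous_on_fst continuous_on_id) auto

section \<open>Balance identities along viable trajectories\<close>

lemma solution_continuous:
  assumes "is_solution f y0 u x"
  shows "continuous_on {0..} x"
proof -
  let ?g = "\<lambda>s. f (x s, u s)"
  have int: "set_integrable lebesgue {0..t} ?g" for t
    using assms by (cases "0 \<le> t") (auto simp: is_solution_def set_integrable_def)
  have "x t = y0 + integral {0..t} ?g" if "t \<in> {0..}" for t
    using assms that set_lebesgue_integral_eq_integral(2)[OF int, of t] by (simp add: is_solution_def)
  moreover have "continuous_on {0..} (\<lambda>t. y0 + integral {0..t} ?g)"
    by (intro continuous_intros continuous_on_indefinite_integral_atLeast
        set_lebesgue_integral_eq_integral(1)[OF int])
  ultimately show ?thesis by (rule continuous_on_eq[OF _ sym, rotated])
qed

text \<open>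
  The time set \<open>J\<close> is \<open>{0..T}\<close> for the averaged problem and \<open>{0..}\<close> for the discounted one.
  Staying in the compact set \<open>Y\<close> on \<open>J\<close> is what bounds all observables along the trajectory.
\<close>

locale viable_trajectory =
  fixes f :: "(real ^ 'm) \<times> 'u::metric_space \<Rightarrow> real ^ 'm"
    and U :: "'u set" and Y :: "(real ^ 'm) set" and y0 :: "real ^ 'm"
    and u :: "real \<Rightarrow> 'u" and x :: "real \<Rightarrow> real ^ 'm" and J :: "real set"
  assumes compact_U: "compact U" and compact_Y: "compact Y"
    and f_cont: "continuous_on (Y \<times> U) f"
    and control: "u \<in> controls U" and sol: "is_solution f y0 u x"
    and J_pos: "J \<subseteq> {0..}"
    and viable: "\<And>t. t \<in> J \<Longrightarrow> x t \<in> Y"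
begin

lemma in_domain: "t \<in> J \<Longrightarrow> x t \<in> Y \<and> u t \<in> U"
  using viable control_in_set[OF control] J_pos by auto

lemma observable_bounded:
  fixes q :: "(real ^ 'm) \<times> 'u \<Rightarrow> 'b::real_normed_vector"
  assumes "continuous_on (Y \<times> U) q"
  obtains B where "\<And>t. t \<in> J \<Longrightarrow> norm (q (x t, u t)) \<le> B"
proof -
  have "bounded (q ` (Y \<times> U))"
    by (intro compact_imp_bounded compact_continuous_image assms compact_Times compact_Y compact_U)
  then obtain B where "\<And>z. z \<in> Y \<times> U \<Longrightarrow> norm (q z) \<le> B" unfolding bounded_iff by blast
  then show ?thesis using in_domain that by blast
qed

lemma pair_measurable:
  assumes "I \<subseteq> J"
  shows "(\<lambda>t. (x t, u t)) \<in> lebesgue_on I \<rightarrow>\<^sub>M restrict_space borel (Y \<times> U)"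
  using assms J_pos viable
  by (intro state_control_measurable solution_continuous[OF sol] control) auto

lemma weighted_observable_integrable:
  fixes q :: "(real ^ 'm) \<times> 'u \<Rightarrow> real"
  assumes I: "I \<subseteq> J" "I \<in> sets lebesgue"
    and \<omega>: "set_integrable lebesgue I \<omega>" and q: "continuous_on (Y \<times> U) q"
  shows "set_integrable lebesgue I (\<lambda>t. \<omega> t * q (x t, u t))"
proof -
  obtain B where B: "\<And>t. t \<in> J \<Longrightarrow> norm (q (x t, u t)) \<le> B"
    using observable_bounded[OF q] by blast
  have "(\<lambda>t. q (x t, u t) * \<omega> t) absolutely_integrable_on I"
  proof (rule absolutely_integrable_bounded_measurable_product_real)
    show "(\<lambda>t. q (x t, u t)) \<in> borel_measurable (lebesgue_on I)"
      by (rule measurable_compose[OF pair_measurable[OF I(1)]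
            borel_measurable_continuous_on_restrict[OF q]])
    show "bounded ((\<lambda>t. q (x t, u t)) ` I)"
      using B I(1) unfolding bounded_iff by blast
  qed (use I \<omega> in auto)
  then show ?thesis by (simp add: mult.commute)
qed

lemma initial_state: "x 0 = y0"
proof -
  let ?g = "\<lambda>s. f (x s, u s)"
  have at_0: "set_integrable lebesgue {0..0} ?g \<and> x 0 = y0 + (LINT s:{0..0}|lebesgue. ?g s)"
    using sol unfolding is_solution_def by (rule allE[of _ 0]) simp
  then have "(LINT s:{0..0}|lebesgue. ?g s) = integral {0..0} ?g"
    by (intro set_lebesgue_integral_eq_integral(2)) (rule conjunct1)
  also have "\<dots> = 0" by simp
  finally show ?thesis using at_0 by (metis add.right_neutral)
qed

text \<open>
  The source of all relations between trajectories and the linear constraints: the chain rule for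
  \<open>(t, y) \<mapsto> \<omega> t * (\<phi> y - \<phi> y0)\<close> along the curve \<open>t \<mapsto> (t, x t)\<close>, whose velocity is
  \<open>(1, f (x t, u t))\<close>.  Adding time as a state coordinate turns the product rule into an instance of
  the chain rule.  The weights used below are \<open>1\<close>, \<open>1 - t / T\<close> and \<open>exp (- lam * t)\<close>.
\<close>

lemma weighted_balance:
  assumes "0 \<le> T" and TJ: "{0..T} \<subseteq> J" and \<phi>: "\<phi> \<in> C1"
    and \<omega>: "\<And>t. (\<omega> has_real_derivative \<omega>' t) (at t)" and \<omega>': "continuous_on {0..T} \<omega>'"
  shows "(LINT t:{0..T}|lebesgue. \<omega>' t * (\<phi> (x t) - \<phi> y0))
       + (LINT t:{0..T}|lebesgue. \<omega> t * (grad \<phi> (x t) \<bullet> f (x t, u t))) = \<omega> T * (\<phi> (x T) - \<phi> y0)"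
proof -
  let ?I = "{0..T}"
  let ?w = "\<lambda>t. (1::real, f (x t, u t))"
  let ?D = "\<lambda>t. (\<omega>' t * (\<phi> (x t) - \<phi> y0), \<omega> t *\<^sub>R grad \<phi> (x t))"
  let ?F = "\<lambda>z. \<omega> (fst z) * (\<phi> (snd z) - \<phi> y0)"
  have x_cont: "continuous_on ?I x"
    using solution_continuous[OF sol] by (rule continuous_on_subset) auto
  have \<omega>_cont: "continuous_on ?I \<omega>"
    using \<omega> by (auto intro!: continuous_at_imp_continuous_on DERIV_isCont)
  obtain B where B: "\<And>t. t \<in> J \<Longrightarrow> norm (f (x t, u t)) \<le> B"
    using observable_bounded[OF f_cont] by blast
  have "((\<lambda>t. ?D t \<bullet> ?w t) has_integral (?F (T, x T) - ?F (0, x 0))) ?I"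
  proof (rule chain_rule_integral_curve[where M = "1 + B"])
    have "(\<lambda>t. f (x t, u t)) \<in> borel_measurable (lebesgue_on ?I)"
      by (rule measurable_compose[OF pair_measurable[OF TJ]
            borel_measurable_continuous_on_restrict[OF f_cont]])
    then show "?w \<in> borel_measurable (lebesgue_on ?I)" by measurable
    fix t assume t: "t \<in> ?I"
    show "norm (?w t) \<le> 1 + B"
      using norm_Pair_le[of "1::real" "f (x t, u t)"] B[OF subsetD[OF TJ t]] by simp
    have int: "((\<lambda>s. f (x s, u s)) has_integral (x t - x 0)) {0..t}"
    proof -
      have si: "set_integrable lebesgue {0..t} (\<lambda>s. f (x s, u s))"
        and "x t = y0 + (LINT s:{0..t}|lebesgue. f (x s, u s))"
        using sol t unfolding is_solution_def by auto
      then have "x t - x 0 = (LINT s:{0..t}|lebesgue. f (x s, u s))"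
        unfolding initial_state by (metis add_diff_cancel_left')
      then show ?thesis using has_integral_set_lebesgue[OF si] by metis
    qed
    have "((\<lambda>s. (1::real, 0) + (0, f (x s, u s))) has_integral ((t, 0) + (0, x t - x 0))) {0..t}"
    proof (rule has_integral_add)
      show "((\<lambda>s. (1::real, 0::real^'m)) has_integral (t, 0)) {0..t}"
        using has_integral_const_real[of "(1::real, 0::real^'m)" 0 t] t by simp
      have "bounded_linear (\<lambda>v::real^'m. (0::real, v))"
        by (intro bounded_linear_Pair bounded_linear_zero bounded_linear_ident)
      from has_integral_linear[OF int this]
      show "((\<lambda>s. (0::real, f (x s, u s))) has_integral (0, x t - x 0)) {0..t}"
        by (simp add: o_def)
    qed
    then show "(?w has_integral ((t, x t) - (0, x 0))) {0..t}" by simp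
    have "(\<phi> has_derivative (\<lambda>h. h \<bullet> grad \<phi> (x t))) (at (snd (t, x t)))"
      using C1_gderiv[OF \<phi>, of "x t"] by (simp add: gderiv_def)
    from has_derivative_compose[OF has_derivative_snd[OF has_derivative_ident] this]
    have d1: "((\<lambda>z. \<phi> (snd z)) has_derivative (\<lambda>h. snd h \<bullet> grad \<phi> (x t))) (at (t, x t))" .
    have "(\<omega> has_derivative (\<lambda>h. \<omega>' t * h)) (at (fst (t, x t)))"
      using \<omega>[of t] by (simp add: has_field_derivative_def)
    from has_derivative_compose[OF has_derivative_fst[OF has_derivative_ident] this]
    have d2: "((\<lambda>z. \<omega> (fst z)) has_derivative (\<lambda>h. \<omega>' t * fst h)) (at (t, x t))" .
    show "GDERIV ?F (t, x t) :> ?D t"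
      unfolding gderiv_def
      by (rule has_derivative_eq_rhs[OF has_derivative_mult[OF d2 has_derivative_diff[OF d1 has_derivative_const]]])
        (auto simp: fun_eq_iff inner_prod_def algebra_simps)
  next
    show "continuous_on ?I ?D"
      by (intro continuous_intros \<omega>' \<omega>_cont continuous_on_compose2[OF C1_continuous[OF \<phi>, of UNIV] x_cont]
          continuous_on_compose2[OF C1_grad_continuous[OF \<phi>, of UNIV] x_cont]) auto
  qed (rule \<open>0 \<le> T\<close>)
  then have *: "integral ?I (\<lambda>t. \<omega>' t * (\<phi> (x t) - \<phi> y0) + \<omega> t * (grad \<phi> (x t) \<bullet> f (x t, u t)))
      = \<omega> T * (\<phi> (x T) - \<phi> y0)"
    by (simp add: integral_unique initial_state)
  have 1: "set_integrable lebesgue ?I (\<lambda>t. \<omega>' t * (\<phi> (x t) - \<phi> y0))"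
    using weighted_observable_integrable[OF TJ _ absolutely_integrable_continuous_real[OF \<omega>'] increment_continuous[OF \<phi>]]
    by simp
  have 2: "set_integrable lebesgue ?I (\<lambda>t. \<omega> t * (grad \<phi> (x t) \<bullet> f (x t, u t)))"
    using weighted_observable_integrable[OF TJ _ absolutely_integrable_continuous_real[OF \<omega>_cont] grad_f_continuous[OF f_cont \<phi>]]
    by simp
  show ?thesis
    using set_lebesgue_integral_eq_integral(2)[OF set_integral_add(1)[OF 1 2]] set_integral_add(2)[OF 1 2] *
    by simp
qed

lemma exp_integrable: "0 < lam \<Longrightarrow> set_integrable lebesgue {0::real..} (\<lambda>t. exp (- lam * t))"
  using integrable_on_exp_minus_to_infinity[of lam 0]
  by (intro nonnegative_absolutely_integrable_1) auto

text \<open>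
  The balance with weight \<open>exp (- lam * t)\<close> on \<open>{0..T}\<close>, as \<open>T\<close> tends to infinity: the boundary
  term vanishes because \<open>\<phi>\<close> is bounded along the trajectory.  The right-hand side carries the increments
  of \<open>\<phi>\<close> and the left-hand side its derivative along \<open>f\<close>, so one identity serves both
  defining conditions of \<open>W\<^sub>2\<close>.
\<close>

lemma discounted_balance:
  assumes J: "J = {0..}" and lam: "0 < lam" and \<phi>: "\<phi> \<in> C1"
  shows "(LINT t:{0..}|lebesgue. exp (- lam * t) * (grad \<phi> (x t) \<bullet> f (x t, u t)))
       = lam * (LINT t:{0..}|lebesgue. exp (- lam * t) * (\<phi> (x t) - \<phi> y0))"
proof -
  let ?a = "\<lambda>t. exp (- lam * t) * (\<phi> (x t) - \<phi> y0)"
  let ?b = "\<lambda>t. exp (- lam * t) * (grad \<phi> (x t) \<bullet> f (x t, u t))"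
  have a: "set_integrable lebesgue {0..} ?a" and b: "set_integrable lebesgue {0..} ?b"
    using weighted_observable_integrable[OF _ _ exp_integrable[OF lam] increment_continuous[OF \<phi>]]
      weighted_observable_integrable[OF _ _ exp_integrable[OF lam] grad_f_continuous[OF f_cont \<phi>]] J
    by auto
  have fin: "(LINT t:{0..T}|lebesgue. ?b t) - lam * (LINT t:{0..T}|lebesgue. ?a t) = ?a T" if "0 \<le> T" for T
  proof -
    have "(LINT t:{0..T}|lebesgue. (- lam * exp (- lam * t)) * (\<phi> (x t) - \<phi> y0))
       + (LINT t:{0..T}|lebesgue. ?b t) = ?a T"
      by (rule weighted_balance[OF that _ \<phi>])
        (use J in \<open>auto intro!: derivative_eq_intros continuous_intros\<close>)
    moreover have "(LINT t:{0..T}|lebesgue. (- lam * exp (- lam * t)) * (\<phi> (x t) - \<phi> y0))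
       = - lam * (LINT t:{0..T}|lebesgue. ?a t)"
      by (subst set_integral_mult_right[symmetric]) (simp add: mult.assoc)
    ultimately show ?thesis by simp
  qed
  have "((\<lambda>T. (LINT t:{0..T}|lebesgue. ?b t) - lam * (LINT t:{0..T}|lebesgue. ?a t)) \<longlongrightarrow>
      (LINT t:{0..}|lebesgue. ?b t) - lam * (LINT t:{0..}|lebesgue. ?a t)) at_top"
    by (intro tendsto_intros tendsto_set_lebesgue_integral_at_top a b) auto
  moreover have "((\<lambda>T. (LINT t:{0..T}|lebesgue. ?b t) - lam * (LINT t:{0..T}|lebesgue. ?a t)) \<longlongrightarrow> 0) at_top"
  proof -
    obtain B where B: "\<And>t. t \<in> J \<Longrightarrow> norm (case (x t, u t) of (y, v) \<Rightarrow> \<phi> y - \<phi> y0) \<le> B"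
      using observable_bounded[OF increment_continuous[OF \<phi>]] by blast
    have "((\<lambda>T. B * exp (- lam * T)) \<longlongrightarrow> 0) at_top"
      by (intro tendsto_mult_right_zero filterlim_compose[OF exp_at_bot]
          filterlim_tendsto_neg_mult_at_bot[OF tendsto_const _ filterlim_ident]) (use lam in simp)
    then have "(?a \<longlongrightarrow> 0) at_top"
      by (rule Lim_null_comparison[rotated])
        (use B J in \<open>auto intro!: eventually_at_top_linorderI[of 0] simp: abs_mult mult.commute\<close>)
    then show ?thesis
      by (rule Lim_transform_eventually)
        (use fin in \<open>auto intro!: eventually_at_top_linorderI[of 0]\<close>)
  qed
  ultimately have "(LINT t:{0..}|lebesgue. ?b t) - lam * (LINT t:{0..}|lebesgue. ?a t) = 0"
    by (rule tendsto_unique[rotated]) simp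
  then show ?thesis by simp
qed

end

section \<open>Limits of occupational measures and the dual bound\<close>

text \<open>
  The two families of occupational measures enter only through two properties: they are stationary
  up to an error that vanishes in the limit, and each of them satisfies the second condition of
  \<open>W\<^sub>2\<close> exactly, with a single representing measure \<open>\<xi>\<close>.  Weak convergence transports the first to
  the limit, and the representing measures of the approximants form the sequence that \<open>W\<^sub>2\<close> asks for.
  The rate \<open>e T\<close> is \<open>1 / T\<close> for time averages and the discount rate itself for discounted ones.
\<close>

lemma W2_contains_limits:
  fixes f :: "(real ^ 'm) \<times> 'u::metric_space \<Rightarrow> real ^ 'm"
  assumes f: "continuous_on (Y \<times> U) f" and e: "(e \<longlongrightarrow> 0) F"
    and stationary: "\<And>\<phi>. \<phi> \<in> C1 \<Longrightarrow> \<exists>B. \<forall>T>0. \<forall>\<gamma>\<in>G T.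
        \<bar>\<integral>(y, u). grad \<phi> y \<bullet> f (y, u) \<partial>\<gamma>\<bar> \<le> B * e T"
    and represented: "\<And>T \<gamma>. 0 < T \<Longrightarrow> \<gamma> \<in> G T \<Longrightarrow>
        \<exists>\<xi>\<in>finite_borel_measures (Y \<times> U). \<forall>\<phi>\<in>C1.
          (\<integral>(y, u). grad \<phi> y \<bullet> f (y, u) \<partial>\<xi>) = (\<integral>(y, u). \<phi> y - \<phi> y0 \<partial>\<gamma>)"
  shows "limsup_measures (Y \<times> U) F G \<subseteq> W\<^sub>2 f U Y y0"
proof
  fix \<gamma> assume "\<gamma> \<in> limsup_measures (Y \<times> U) F G"
  then obtain p \<gamma>s where prob: "\<gamma> \<in> prob_borel_measures (Y \<times> U)"
    and p: "filterlim p F sequentially" and G: "\<And>l::nat. 0 < p l \<and> \<gamma>s l \<in> G (p l)"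
    and lim: "weak_star_lim (Y \<times> U) \<gamma>s \<gamma>"
    unfolding limsup_measures_def by blast
  note limD = lim[unfolded weak_star_lim_def, rule_format]
  have "(\<integral>(y, u). grad \<phi> y \<bullet> f (y, u) \<partial>\<gamma>) = 0" if \<phi>: "\<phi> \<in> C1" for \<phi>
  proof -
    let ?q = "\<lambda>(y, u). grad \<phi> y \<bullet> f (y, u)"
    obtain B where B: "\<And>T \<gamma>. 0 < T \<Longrightarrow> \<gamma> \<in> G T \<Longrightarrow> \<bar>integral\<^sup>L \<gamma> ?q\<bar> \<le> B * e T"
      using stationary[OF \<phi>] by blast
    have "(\<lambda>l. B * e (p l)) \<longlonglongrightarrow> 0"
      by (intro tendsto_mult_right_zero filterlim_compose[OF e p])
    then have "(\<lambda>l. integral\<^sup>L (\<gamma>s l) ?q) \<longlonglongrightarrow> 0"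
      by (rule Lim_null_comparison[rotated]) (use B G in auto)
    with limD[OF grad_f_continuous[OF f \<phi>]] show ?thesis by (rule LIMSEQ_unique)
  qed
  then have "\<gamma> \<in> W f U Y" using prob by (simp add: W_def)
  moreover have "\<exists>\<xi>. \<forall>l. \<xi> l \<in> finite_borel_measures (Y \<times> U) \<and> (\<forall>\<phi>\<in>C1.
          (\<integral>(y, u). grad \<phi> y \<bullet> f (y, u) \<partial>(\<xi> l)) = (\<integral>(y, u). \<phi> y - \<phi> y0 \<partial>(\<gamma>s l)))"
    using represented G by (intro choice allI) blast
  then obtain \<xi> where "\<And>l. \<xi> l \<in> finite_borel_measures (Y \<times> U)" and
    "\<And>l \<phi>. \<phi> \<in> C1 \<Longrightarrow> (\<integral>(y, u). grad \<phi> y \<bullet> f (y, u) \<partial>(\<xi> l)) = (\<integral>(y, u). \<phi> y - \<phi> y0 \<partial>(\<gamma>s l))"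
    by blast
  ultimately show "\<gamma> \<in> W\<^sub>2 f U Y y0"
    unfolding W\<^sub>2_def using limD[OF increment_continuous] by (auto intro!: exI[of _ \<xi>])
qed

lemma prob_integral_abs_le:
  fixes q :: "'a \<Rightarrow> real"
  assumes "prob_space \<gamma>" and "q \<in> borel_measurable \<gamma>" and "\<And>z. z \<in> space \<gamma> \<Longrightarrow> \<bar>q z\<bar> \<le> B"
  shows "\<bar>integral\<^sup>L \<gamma> q\<bar> \<le> B"
proof -
  interpret prob_space \<gamma> by fact
  have "integrable \<gamma> q"
    by (rule integrable_const_bound[where B = B]) (use assms in auto)
  then show ?thesis
    using integral_ge_const[of q "- B"] integral_le_const[of q B] assms(3) abs_le_iff
    by (smt (verit, best) AE_I2)
qed

lemma viable_trajectoryI: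
  fixes f :: "(real ^ 'm) \<times> 'u::metric_space \<Rightarrow> real ^ 'm"
  assumes "compact U" and "compact Y" and f: "continuous_on (UNIV \<times> U) f"
    and "\<exists>L. \<forall>v\<in>U. L-lipschitz_on UNIV (\<lambda>y. f (y, v))"
    and u: "u \<in> controls U" and "J \<subseteq> {0..}"
    and "\<And>t. t \<in> J \<Longrightarrow> trajectory f y0 u t \<in> Y"
  shows "viable_trajectory f U Y y0 u (trajectory f y0 u) J"
proof -
  have "is_solution f y0 u (trajectory f y0 u)"
    unfolding trajectory_def using solution_exists[OF \<open>compact U\<close> f _ u] assms(4)
    by (intro someI_ex[of "is_solution f y0 u"]) blast
  then show ?thesis
    using assms by unfold_locales (auto intro: continuous_on_subset)
qed

context viable_trajectory
begin

lemma average_balance: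
  assumes "0 < T" and "{0..T} \<subseteq> J" and \<phi>: "\<phi> \<in> C1"
  shows "(LINT t:{0..T}|lebesgue. grad \<phi> (x t) \<bullet> f (x t, u t)) = \<phi> (x T) - \<phi> y0"
  using weighted_balance[of T \<phi> "\<lambda>_. 1" "\<lambda>_. 0"] assms by (simp add: set_lebesgue_integral_def)

text \<open>
  By Fubini the time average of \<open>\<phi> (x t) - \<phi> y0 = \<integral>\<^sub>0\<^sup>t \<nabla>\<phi> \<bullet> f\<close> counts the velocity at time
  \<open>t\<close> once for every later time.  The weight \<open>1 - t / T\<close>, the remaining fraction of the horizon,
  encodes this and moreover kills the boundary term at \<open>T\<close>.
\<close>

lemma remaining_time_balance:
  assumes "0 < T" and "{0..T} \<subseteq> J" and \<phi>: "\<phi> \<in> C1"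
  shows "(LINT t:{0..T}|lebesgue. (1 - t / T) * (grad \<phi> (x t) \<bullet> f (x t, u t)))
       = 1 / T * (LINT t:{0..T}|lebesgue. \<phi> (x t) - \<phi> y0)"
proof -
  have "(LINT t:{0..T}|lebesgue. (- 1 / T) * (\<phi> (x t) - \<phi> y0))
      + (LINT t:{0..T}|lebesgue. (1 - t / T) * (grad \<phi> (x t) \<bullet> f (x t, u t))) = (1 - T / T) * (\<phi> (x T) - \<phi> y0)"
    by (rule weighted_balance[OF _ assms(2) \<phi>])
      (use assms in \<open>auto intro!: derivative_eq_intros continuous_intros\<close>)
  then show ?thesis using \<open>0 < T\<close> by (simp only: set_integral_mult_right) simp
qed

text \<open>
  The occupational measure in which time \<open>t\<close> is weighted by the remaining fraction of the horizon; it
  serves as the representing measure \<open>\<xi>\<close> for the averaged problem.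
\<close>

definition remaining_time_measure :: "real \<Rightarrow> ((real ^ 'm) \<times> 'u) measure" where
  "remaining_time_measure T =
    distr (density (lebesgue_on {0..T}) (\<lambda>t. ennreal (1 - t / T)))
      (restrict_space borel (Y \<times> U)) (\<lambda>t. (x t, u t))"

lemma
  assumes "0 < T" and TJ: "{0..T} \<subseteq> J"
  shows remaining_time_measure_finite: "remaining_time_measure T \<in> finite_borel_measures (Y \<times> U)"
    and integral_remaining_time_measure: "\<And>q :: (real ^ 'm) \<times> 'u \<Rightarrow> real. continuous_on (Y \<times> U) q \<Longrightarrow>
        integral\<^sup>L (remaining_time_measure T) q = (LINT t:{0..T}|lebesgue. (1 - t / T) * q (x t, u t))"
proof -
  let ?L = "lebesgue_on {0..T}"
  let ?D = "density ?L (\<lambda>t. ennreal (1 - t / T))"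
  have [measurable]: "(\<lambda>t. (x t, u t)) \<in> ?L \<rightarrow>\<^sub>M restrict_space borel (Y \<times> U)"
    by (rule pair_measurable[OF TJ])
  have w: "(\<lambda>t. 1 - t / T) \<in> borel_measurable ?L"
    by (intro continuous_imp_measurable_on_sets_lebesgue continuous_intros) (use \<open>0 < T\<close> in auto)
  have "emeasure ?D (space ?D) = (\<integral>\<^sup>+t. ennreal (1 - t / T) \<partial>?L)"
    using w by (subst emeasure_density) (auto intro!: nn_integral_cong)
  also have "\<dots> \<le> (\<integral>\<^sup>+t. 1 \<partial>?L)"
    using \<open>0 < T\<close> by (intro nn_integral_mono) (auto simp: ennreal_le_1)
  also have "\<dots> < \<infinity>" using \<open>0 < T\<close> by (simp add: emeasure_restrict_space)
  finally have "finite_measure ?D" by (intro finite_measureI) simp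
  then have "finite_measure (remaining_time_measure T)"
    unfolding remaining_time_measure_def by (rule finite_measure.finite_measure_distr) simp
  then show "remaining_time_measure T \<in> finite_borel_measures (Y \<times> U)"
    by (simp add: finite_borel_measures_def remaining_time_measure_def)
  fix q :: "(real ^ 'm) \<times> 'u \<Rightarrow> real" assume "continuous_on (Y \<times> U) q"
  then have q[measurable]: "q \<in> borel_measurable (restrict_space borel (Y \<times> U))"
    by (rule borel_measurable_continuous_on_restrict)
  have "integral\<^sup>L (remaining_time_measure T) q = (\<integral>t. q (x t, u t) \<partial>?D)"
    unfolding remaining_time_measure_def by (rule integral_distr) measurable
  also have "\<dots> = (\<integral>t. (1 - t / T) *\<^sub>R q (x t, u t) \<partial>?L)"
    by (rule integral_density) (use w \<open>0 < T\<close> in \<open>auto intro!: AE_I2\<close>)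
  also have "\<dots> = (LINT t:{0..T}|lebesgue. (1 - t / T) * q (x t, u t))"
    by (simp add: set_lebesgue_integral_def integral_restrict_space)
  finally show "integral\<^sup>L (remaining_time_measure T) q = (LINT t:{0..T}|lebesgue. (1 - t / T) * q (x t, u t))" .
qed

text \<open>
  Integrating the first dual constraint along the trajectory, the \<open>\<psi>\<close> term has a
  nonnegative integral by the remaining-time balance and the second constraint, while the \<open>\<eta>\<close> term telescopes to
  boundary values, whose size does not grow with the horizon.
\<close>

lemma average_cost_ge:
  assumes T: "0 < T" and J: "J = {0..T}" and k: "continuous_on (Y \<times> U) k"
    and \<psi>: "\<psi> \<in> C1" and \<eta>: "\<eta> \<in> C1"
    and feas: "\<And>y v. y \<in> Y \<Longrightarrow> v \<in> U \<Longrightarrow> k (y, v) + (\<psi> y0 - \<psi> y) + grad \<eta> y \<bullet> f (y, v) - \<mu> \<ge> 0"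
    and mono: "\<And>y v. y \<in> Y \<Longrightarrow> v \<in> U \<Longrightarrow> grad \<psi> y \<bullet> f (y, v) \<ge> 0"
    and C: "\<And>y. y \<in> Y \<Longrightarrow> \<bar>\<eta> y\<bar> \<le> C"
  shows "T * \<mu> - 2 * C \<le> (LINT t:{0..T}|lebesgue. k (x t, u t))"
proof -
  have one: "set_integrable lebesgue {0..T} (\<lambda>_. 1 :: real)"
    by (intro absolutely_integrable_continuous_real continuous_intros)
  note int = weighted_observable_integrable[of "{0..T}", OF _ _ one, simplified mult_1 J, simplified]
  have k_int: "set_integrable lebesgue {0..T} (\<lambda>t. k (x t, u t))"
    and \<psi>_int: "set_integrable lebesgue {0..T} (\<lambda>t. \<psi> (x t) - \<psi> y0)"
    and \<eta>_int: "set_integrable lebesgue {0..T} (\<lambda>t. grad \<eta> (x t) \<bullet> f (x t, u t))"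
    using int[OF k] int[OF increment_continuous[OF \<psi>]] int[OF grad_f_continuous[OF f_cont \<eta>]] by auto
  have "0 \<le> (LINT t:{0..T}|lebesgue. (1 - t / T) * (grad \<psi> (x t) \<bullet> f (x t, u t)))"
    unfolding set_lebesgue_integral_def using in_domain mono T J
    by (intro Bochner_Integration.integral_nonneg) (auto simp: indicator_def)
  then have \<psi>_pos: "0 \<le> (LINT t:{0..T}|lebesgue. \<psi> (x t) - \<psi> y0)"
    using remaining_time_balance[OF T _ \<psi>] J T by (simp add: zero_le_divide_iff)
  have mu: "set_integrable lebesgue {0..T} (\<lambda>_. \<mu>)" "(LINT t:{0..T}|lebesgue. \<mu>) = T * \<mu>"
    using T by (auto intro!: absolutely_integrable_continuous_real simp: set_lebesgue_integral_def)
  have "T * \<mu> + (LINT t:{0..T}|lebesgue. \<psi> (x t) - \<psi> y0) - (\<eta> (x T) - \<eta> y0)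
      = (LINT t:{0..T}|lebesgue. \<mu> + (\<psi> (x t) - \<psi> y0) - grad \<eta> (x t) \<bullet> f (x t, u t))"
    using average_balance[OF T _ \<eta>] J mu \<psi>_int \<eta>_int by (simp add: set_integral_add set_integral_diff)
  also have "\<dots> \<le> (LINT t:{0..T}|lebesgue. k (x t, u t))"
  proof (intro mu(1) \<psi>_int \<eta>_int k_int set_integral_mono set_integral_add set_integral_diff)
    fix t assume "t \<in> {0..T}"
    then show "\<mu> + (\<psi> (x t) - \<psi> y0) - grad \<eta> (x t) \<bullet> f (x t, u t) \<le> k (x t, u t)"
      using feas[of "x t" "u t"] in_domain[of t] J by auto
  qed
  finally have "T * \<mu> - (\<eta> (x T) - \<eta> y0) \<le> (LINT t:{0..T}|lebesgue. k (x t, u t))"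
    using \<psi>_pos by linarith
  moreover have "\<bar>\<eta> (x T)\<bar> \<le> C" "\<bar>\<eta> y0\<bar> \<le> C"
    using C viable[of T] viable[of 0] J T initial_state by auto
  ultimately show ?thesis by linarith
qed

text \<open>
  The discounted balance replaces both relations of the averaged case: it shows that the \<open>\<psi>\<close>
  term is nonnegative, and it makes the \<open>\<eta>\<close> term \<open>lam\<close> times an integral of size at most
  \<open>2 * C / lam\<close>.
\<close>

lemma discounted_cost_ge:
  assumes lam: "0 < lam" and J: "J = {0..}" and k: "continuous_on (Y \<times> U) k"
    and \<psi>: "\<psi> \<in> C1" and \<eta>: "\<eta> \<in> C1"
    and feas: "\<And>y v. y \<in> Y \<Longrightarrow> v \<in> U \<Longrightarrow> k (y, v) + (\<psi> y0 - \<psi> y) + grad \<eta> y \<bullet> f (y, v) - \<mu> \<ge> 0"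
    and mono: "\<And>y v. y \<in> Y \<Longrightarrow> v \<in> U \<Longrightarrow> grad \<psi> y \<bullet> f (y, v) \<ge> 0"
    and C: "\<And>y. y \<in> Y \<Longrightarrow> \<bar>\<eta> y\<bar> \<le> C"
  shows "\<mu> / lam - 2 * C \<le> (LINT t:{0..}|lebesgue. exp (- lam * t) * k (x t, u t))"
proof -
  let ?e = "\<lambda>t. exp (- lam * t)"
  have total: "(LINT t:{0..}|lebesgue. ?e t) = 1 / lam"
    using set_lebesgue_integral_eq_integral(2)[OF exp_integrable[OF lam]]
      has_integral_exp_minus_to_infinity[OF lam, of 0] by (simp add: integral_unique)
  have y0: "\<bar>\<eta> y0\<bar> \<le> C"
    using C viable[of 0] J initial_state by auto
  note int = weighted_observable_integrable[OF _ _ exp_integrable[OF lam], unfolded J, simplified]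
  have k_int: "set_integrable lebesgue {0..} (\<lambda>t. ?e t * k (x t, u t))"
    and \<psi>_int: "set_integrable lebesgue {0..} (\<lambda>t. ?e t * (\<psi> (x t) - \<psi> y0))"
    and \<eta>_int: "set_integrable lebesgue {0..} (\<lambda>t. ?e t * (grad \<eta> (x t) \<bullet> f (x t, u t)))"
    and \<eta>0_int: "set_integrable lebesgue {0..} (\<lambda>t. ?e t * (\<eta> (x t) - \<eta> y0))"
    using int[OF k] int[OF increment_continuous[OF \<psi>]] int[OF increment_continuous[OF \<eta>]]
      int[OF grad_f_continuous[OF f_cont \<eta>]] by auto
  have "0 \<le> (LINT t:{0..}|lebesgue. ?e t * (grad \<psi> (x t) \<bullet> f (x t, u t)))"
    unfolding set_lebesgue_integral_def using in_domain mono J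
    by (intro Bochner_Integration.integral_nonneg) (auto simp: indicator_def)
  then have \<psi>_pos: "0 \<le> (LINT t:{0..}|lebesgue. ?e t * (\<psi> (x t) - \<psi> y0))"
    using discounted_balance[OF J lam \<psi>] lam by (simp add: zero_le_mult_iff)
  have const: "set_integrable lebesgue {0..} (\<lambda>t. c * ?e t)"
    "(LINT t:{0..}|lebesgue. c * ?e t) = c / lam" for c
    using set_integrable_mult_right[of c, OF exp_integrable[OF lam]] total
    by (auto simp: set_integral_mult_right)
  have "(LINT t:{0..}|lebesgue. ?e t * (\<eta> (x t) - \<eta> y0)) \<le> (LINT t:{0..}|lebesgue. (2 * C) * ?e t)"
  proof (rule set_integral_mono[OF \<eta>0_int const(1)])
    fix t :: real assume "t \<in> {0..}"
    then have "\<eta> (x t) - \<eta> y0 \<le> 2 * C" using C[OF viable[of t]] y0 J by auto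
    then show "?e t * (\<eta> (x t) - \<eta> y0) \<le> (2 * C) * ?e t" by (simp add: mult.commute)
  qed
  then have "lam * (LINT t:{0..}|lebesgue. ?e t * (\<eta> (x t) - \<eta> y0)) \<le> lam * (2 * C / lam)"
    unfolding const(2) using lam by (intro mult_left_mono) auto
  then have \<eta>_le: "(LINT t:{0..}|lebesgue. ?e t * (grad \<eta> (x t) \<bullet> f (x t, u t))) \<le> 2 * C"
    using discounted_balance[OF J lam \<eta>] lam by simp
  have "\<mu> / lam + (LINT t:{0..}|lebesgue. ?e t * (\<psi> (x t) - \<psi> y0))
        - (LINT t:{0..}|lebesgue. ?e t * (grad \<eta> (x t) \<bullet> f (x t, u t)))
      = (LINT t:{0..}|lebesgue. \<mu> * ?e t + ?e t * (\<psi> (x t) - \<psi> y0) - ?e t * (grad \<eta> (x t) \<bullet> f (x t, u t)))"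
    using const[of \<mu>] \<psi>_int \<eta>_int by (simp add: set_integral_add set_integral_diff)
  also have "\<dots> \<le> (LINT t:{0..}|lebesgue. ?e t * k (x t, u t))"
  proof (intro set_integral_mono set_integral_add set_integral_diff const \<psi>_int \<eta>_int k_int)
    fix t :: real assume "t \<in> {0..}"
    then have "\<mu> + (\<psi> (x t) - \<psi> y0) - grad \<eta> (x t) \<bullet> f (x t, u t) \<le> k (x t, u t)"
      using feas[of "x t" "u t"] in_domain[of t] J by auto
    then have "?e t * (\<mu> + (\<psi> (x t) - \<psi> y0) - grad \<eta> (x t) \<bullet> f (x t, u t)) \<le> ?e t * k (x t, u t)"
      by (rule mult_left_mono) simp
    then show "\<mu> * ?e t + ?e t * (\<psi> (x t) - \<psi> y0) - ?e t * (grad \<eta> (x t) \<bullet> f (x t, u t)) \<le> ?e t * k (x t, u t)"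
      by (simp add: algebra_simps)
  qed
  finally show ?thesis using \<psi>_pos \<eta>_le by linarith
qed

end

lemma continuous_on_compact_abs_bounded:
  fixes g :: "'a::topological_space \<Rightarrow> real"
  assumes "compact S" and "continuous_on S g"
  obtains C where "\<And>y. y \<in> S \<Longrightarrow> \<bar>g y\<bar> \<le> C"
proof -
  have "bounded (g ` S)" by (intro compact_imp_bounded compact_continuous_image assms)
  then show ?thesis using that unfolding bounded_iff by auto
qed

text \<open>
  A lower bound for each feasible triplet suffices, with an error that may depend on the triplet: the
  supremum over triplets is taken after the limit.
\<close>

lemma d_star_le_Liminf:
  fixes f :: "(real ^ 'm) \<times> 'u::metric_space \<Rightarrow> real ^ 'm"
  assumes "compact Y" and "F \<noteq> bot" and e: "(e \<longlongrightarrow> 0) F"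
    and bound: "\<And>\<mu> \<psi> \<eta> C. \<psi> \<in> C1 \<Longrightarrow> \<eta> \<in> C1 \<Longrightarrow>
        (\<And>y v. y \<in> Y \<Longrightarrow> v \<in> U \<Longrightarrow> k (y, v) + (\<psi> y0 - \<psi> y) + grad \<eta> y \<bullet> f (y, v) - \<mu> \<ge> 0) \<Longrightarrow>
        (\<And>y v. y \<in> Y \<Longrightarrow> v \<in> U \<Longrightarrow> grad \<psi> y \<bullet> f (y, v) \<ge> 0) \<Longrightarrow>
        (\<And>y. y \<in> Y \<Longrightarrow> \<bar>\<eta> y\<bar> \<le> C) \<Longrightarrow>
        \<forall>\<^sub>F T in F. ereal (\<mu> - 2 * C * e T) \<le> v T"
  shows "d_star f k U Y y0 \<le> Liminf F v"
  unfolding d_star_def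
proof (rule Sup_least, clarify)
  fix \<mu> \<psi> \<eta>
  assume C1: "\<psi> \<in> C1" "\<eta> \<in> C1" and feas: "\<forall>y\<in>Y. \<forall>u\<in>U.
      k (y, u) + (\<psi> y0 - \<psi> y) + grad \<eta> y \<bullet> f (y, u) - \<mu> \<ge> 0 \<and> grad \<psi> y \<bullet> f (y, u) \<ge> 0"
  obtain C where C: "\<And>y. y \<in> Y \<Longrightarrow> \<bar>\<eta> y\<bar> \<le> C"
    using continuous_on_compact_abs_bounded[OF \<open>compact Y\<close> C1_continuous[OF C1(2)]] by blast
  have "((\<lambda>T. \<mu> - 2 * C * e T) \<longlongrightarrow> \<mu> - 2 * C * 0) F"
    by (intro tendsto_intros e)
  then have "((\<lambda>T. ereal (\<mu> - 2 * C * e T)) \<longlongrightarrow> ereal \<mu>) F" by simp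
  then have "Liminf F (\<lambda>T. ereal (\<mu> - 2 * C * e T)) = ereal \<mu>"
    by (rule lim_imp_Liminf[OF \<open>F \<noteq> bot\<close>])
  moreover have "Liminf F (\<lambda>T. ereal (\<mu> - 2 * C * e T)) \<le> Liminf F v"
    by (intro Liminf_mono bound[OF C1 _ _ C]) (use feas in auto)
  ultimately show "ereal \<mu> \<le> Liminf F v" by simp
qed

section \<open>Averaged and discounted occupational measures and values\<close>

theorem proposition2p3:
  fixes U :: "'u::metric_space set"
    and f :: "(real ^ 'm) \<times> 'u \<Rightarrow> real ^ 'm"
    and k :: "(real ^ 'm) \<times> 'u \<Rightarrow> real"
    and Y :: "(real ^ 'm) set"
    and y0 :: "real ^ 'm"
  assumes "compact U"
    and "continuous_on (UNIV \<times> U) f"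
    and "\<exists>L. \<forall>u\<in>U. L-lipschitz_on UNIV (\<lambda>y. f (y, u))"
    and "continuous_on (UNIV \<times> U) k"
    and "compact Y"
    and "Y = closure (interior Y)"
    and "y0 \<in> Y"
    and "admissible f U Y y0 \<noteq> {}"
  shows "limsup_measures (Y \<times> U) at_top (Gamma_T f U Y y0) \<subseteq> W\<^sub>2 f U Y y0 \<and>
         Liminf at_top (v_T f k U Y y0) \<ge> d_star f k U Y y0 \<and>
         limsup_measures (Y \<times> U) (at_right 0) (Theta f U Y y0) \<subseteq> W\<^sub>2 f U Y y0 \<and>
         Liminf (at_right 0) (h_disc f k U Y y0) \<ge> d_star f k U Y y0"
proof -
  have f: "continuous_on (Y \<times> U) f" and k: "continuous_on (Y \<times> U) k"
    using assms(2,4) by (auto intro: continuous_on_subset)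
  note viableI = viable_trajectoryI[OF assms(1,5,2,3)]
  have finite_horizon: "viable_trajectory f U Y y0 u (trajectory f y0 u) {0..T}"
    if "u \<in> admissible_upto f U Y y0 T" for u T
    using that by (intro viableI) (auto simp: admissible_upto_def)
  have infinite_horizon: "viable_trajectory f U Y y0 u (trajectory f y0 u) {0..}"
    if "u \<in> admissible f U Y y0" for u
    using that by (intro viableI) (auto simp: admissible_def)
  have inverse_T: "((\<lambda>T::real. 1 / T) \<longlongrightarrow> 0) at_top"
    using tendsto_inverse_0_at_top[OF filterlim_ident] by (simp add: inverse_eq_divide)

  have averages: "limsup_measures (Y \<times> U) at_top (Gamma_T f U Y y0) \<subseteq> W\<^sub>2 f U Y y0"
  proof (rule W2_contains_limits[OF f inverse_T])
    fix \<phi> :: "real ^ 'm \<Rightarrow> real" assume \<phi>: "\<phi> \<in> C1"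
    obtain C where C: "\<And>y. y \<in> Y \<Longrightarrow> \<bar>\<phi> y\<bar> \<le> C"
      using continuous_on_compact_abs_bounded[OF assms(5) C1_continuous[OF \<phi>]] by blast
    have "\<bar>\<integral>(y, u). grad \<phi> y \<bullet> f (y, u) \<partial>\<gamma>\<bar> \<le> 2 * C * (1 / T)"
      if "0 < T" and "\<gamma> \<in> Gamma_T f U Y y0 T" for T \<gamma>
    proof -
      obtain u where u: "u \<in> admissible_upto f U Y y0 T"
        and \<gamma>: "\<And>q. continuous_on (Y \<times> U) q \<Longrightarrow> integral\<^sup>L \<gamma> q = time_average f y0 u T q"
        using \<open>\<gamma> \<in> _\<close> unfolding Gamma_T_def by blast
      interpret viable_trajectory f U Y y0 u "trajectory f y0 u" "{0..T}"
        by (rule finite_horizon[OF u])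
      have "(\<integral>(y, u). grad \<phi> y \<bullet> f (y, u) \<partial>\<gamma>) = 1 / T * (\<phi> (trajectory f y0 u T) - \<phi> y0)"
        using average_balance[OF \<open>0 < T\<close> order_refl \<phi>]
        by (simp add: \<gamma>[OF grad_f_continuous[OF f \<phi>]] time_average_def)
      moreover have "\<bar>\<phi> (trajectory f y0 u T) - \<phi> y0\<bar> \<le> 2 * C"
        using C[OF viable[of T]] C[OF assms(7)] \<open>0 < T\<close> by auto
      ultimately show ?thesis
        using \<open>0 < T\<close> by (simp add: abs_mult divide_right_mono)
    qed
    then show "\<exists>B. \<forall>T>0. \<forall>\<gamma>\<in>Gamma_T f U Y y0 T.
        \<bar>\<integral>(y, u). grad \<phi> y \<bullet> f (y, u) \<partial>\<gamma>\<bar> \<le> B * (1 / T)" by blast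
  next
    fix T \<gamma> assume T: "0 < T" and "\<gamma> \<in> Gamma_T f U Y y0 T"
    then obtain u where u: "u \<in> admissible_upto f U Y y0 T"
      and \<gamma>: "\<And>q. continuous_on (Y \<times> U) q \<Longrightarrow> integral\<^sup>L \<gamma> q = time_average f y0 u T q"
      unfolding Gamma_T_def by blast
    interpret viable_trajectory f U Y y0 u "trajectory f y0 u" "{0..T}"
      by (rule finite_horizon[OF u])
    show "\<exists>\<xi>\<in>finite_borel_measures (Y \<times> U). \<forall>\<phi>\<in>C1.
          (\<integral>(y, u). grad \<phi> y \<bullet> f (y, u) \<partial>\<xi>) = (\<integral>(y, u). \<phi> y - \<phi> y0 \<partial>\<gamma>)"
    proof (intro bexI ballI)
      show "remaining_time_measure T \<in> finite_borel_measures (Y \<times> U)"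
        by (rule remaining_time_measure_finite[OF T order_refl])
      fix \<phi> :: "real ^ 'm \<Rightarrow> real" assume \<phi>: "\<phi> \<in> C1"
      show "(\<integral>(y, u). grad \<phi> y \<bullet> f (y, u) \<partial>(remaining_time_measure T)) = (\<integral>(y, u). \<phi> y - \<phi> y0 \<partial>\<gamma>)"
        using remaining_time_balance[OF T order_refl \<phi>]
        by (simp add: integral_remaining_time_measure[OF T order_refl grad_f_continuous[OF f \<phi>]]
            \<gamma>[OF increment_continuous[OF \<phi>]] time_average_def)
    qed
  qed

  \<comment> \<open>Read from left to right this is near-stationarity; divided by \<open>lam\<close>, it makes \<open>\<gamma> / lam\<close> the measure \<open>\<xi>\<close>.\<close>
  have discounted_stationarity: "(\<integral>(y, u). grad \<phi> y \<bullet> f (y, u) \<partial>\<gamma>) = lam * (\<integral>(y, u). \<phi> y - \<phi> y0 \<partial>\<gamma>)"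
    if "0 < lam" and "\<gamma> \<in> Theta f U Y y0 lam" and \<phi>: "\<phi> \<in> C1" for lam \<gamma> \<phi>
  proof -
    obtain u where u: "u \<in> admissible f U Y y0"
      and \<gamma>: "\<And>q. continuous_on (Y \<times> U) q \<Longrightarrow> integral\<^sup>L \<gamma> q = discounted_average f y0 u lam q"
      using \<open>\<gamma> \<in> _\<close> unfolding Theta_def by blast
    interpret viable_trajectory f U Y y0 u "trajectory f y0 u" "{0..}"
      by (rule infinite_horizon[OF u])
    show ?thesis
      using discounted_balance[OF refl \<open>0 < lam\<close> \<phi>]
      by (simp add: \<gamma>[OF grad_f_continuous[OF f \<phi>]] \<gamma>[OF increment_continuous[OF \<phi>]]
          discounted_average_def)
  qed
  have discounted: "limsup_measures (Y \<times> U) (at_right 0) (Theta f U Y y0) \<subseteq> W\<^sub>2 f U Y y0"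
  proof (rule W2_contains_limits[OF f tendsto_ident_at])
    fix \<phi> :: "real ^ 'm \<Rightarrow> real" assume \<phi>: "\<phi> \<in> C1"
    obtain C where C: "\<And>y. y \<in> Y \<Longrightarrow> \<bar>\<phi> y\<bar> \<le> C"
      using continuous_on_compact_abs_bounded[OF assms(5) C1_continuous[OF \<phi>]] by blast
    have "\<bar>\<integral>(y, u). grad \<phi> y \<bullet> f (y, u) \<partial>\<gamma>\<bar> \<le> 2 * C * lam"
      if lam: "0 < lam" and \<gamma>: "\<gamma> \<in> Theta f U Y y0 lam" for lam \<gamma>
    proof -
      have prob: "prob_space \<gamma>" and sets: "sets \<gamma> = sets (restrict_space borel (Y \<times> U))"
        using \<gamma> by (auto simp: Theta_def prob_borel_measures_def)
      have "\<bar>\<integral>(y, u). \<phi> y - \<phi> y0 \<partial>\<gamma>\<bar> \<le> 2 * C"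
      proof (rule prob_integral_abs_le[OF prob])
        show "(\<lambda>(y, u). \<phi> y - \<phi> y0) \<in> borel_measurable \<gamma>"
          using borel_measurable_continuous_on_restrict[OF increment_continuous[OF \<phi>, of Y U y0]]
          by (simp add: measurable_cong_sets[OF sets refl])
        fix z assume "z \<in> space \<gamma>"
        then have "fst z \<in> Y" using sets_eq_imp_space_eq[OF sets] by (auto simp: space_restrict_space)
        then show "\<bar>case z of (y, u) \<Rightarrow> \<phi> y - \<phi> y0\<bar> \<le> 2 * C"
          using C[of "fst z"] C[OF assms(7)] by (auto simp: case_prod_unfold)
      qed
      then show ?thesis
        using lam by (simp add: discounted_stationarity[OF lam \<gamma> \<phi>] abs_mult mult.commute)
    qed
    then show "\<exists>B. \<forall>lam>0. \<forall>\<gamma>\<in>Theta f U Y y0 lam.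
        \<bar>\<integral>(y, u). grad \<phi> y \<bullet> f (y, u) \<partial>\<gamma>\<bar> \<le> B * lam" by blast
  next
    fix lam \<gamma> assume lam: "0 < lam" and \<gamma>: "\<gamma> \<in> Theta f U Y y0 lam"
    show "\<exists>\<xi>\<in>finite_borel_measures (Y \<times> U). \<forall>\<phi>\<in>C1.
          (\<integral>(y, u). grad \<phi> y \<bullet> f (y, u) \<partial>\<xi>) = (\<integral>(y, u). \<phi> y - \<phi> y0 \<partial>\<gamma>)"
    proof (intro bexI ballI)
      let ?\<xi> = "density \<gamma> (\<lambda>_. ennreal (1 / lam))"
      have sets: "sets \<gamma> = sets (restrict_space borel (Y \<times> U))" and "prob_space \<gamma>"
        using \<gamma> by (auto simp: Theta_def prob_borel_measures_def)
      then have "emeasure ?\<xi> (space ?\<xi>) \<noteq> \<infinity>"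
        using emeasure_density_const[OF sets.top, of \<gamma> "ennreal (1 / lam)"]
        by (simp add: prob_space.emeasure_space_1)
      then show "?\<xi> \<in> finite_borel_measures (Y \<times> U)"
        by (simp add: finite_borel_measures_def sets finite_measureI)
      fix \<phi> :: "real ^ 'm \<Rightarrow> real" assume \<phi>: "\<phi> \<in> C1"
      have "(\<lambda>(y, u). grad \<phi> y \<bullet> f (y, u)) \<in> borel_measurable \<gamma>"
        using borel_measurable_continuous_on_restrict[OF grad_f_continuous[OF f \<phi>]]
        by (simp add: measurable_cong_sets[OF sets refl])
      then have "(\<integral>(y, u). grad \<phi> y \<bullet> f (y, u) \<partial>?\<xi>) = 1 / lam * (\<integral>(y, u). grad \<phi> y \<bullet> f (y, u) \<partial>\<gamma>)"
        using lam by (simp add: integral_density)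
      then show "(\<integral>(y, u). grad \<phi> y \<bullet> f (y, u) \<partial>?\<xi>) = (\<integral>(y, u). \<phi> y - \<phi> y0 \<partial>\<gamma>)"
        using discounted_stationarity[OF lam \<gamma> \<phi>] lam by simp
    qed
  qed

  have "d_star f k U Y y0 \<le> Liminf at_top (v_T f k U Y y0)"
  proof (rule d_star_le_Liminf[OF assms(5) _ inverse_T])
    fix \<mu> \<psi> \<eta> C
    assume feasible: "\<psi> \<in> C1" "\<eta> \<in> C1"
      "\<And>y v. y \<in> Y \<Longrightarrow> v \<in> U \<Longrightarrow> k (y, v) + (\<psi> y0 - \<psi> y) + grad \<eta> y \<bullet> f (y, v) - \<mu> \<ge> 0"
      "\<And>y v. y \<in> Y \<Longrightarrow> v \<in> U \<Longrightarrow> grad \<psi> y \<bullet> f (y, v) \<ge> 0"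
      "\<And>y. y \<in> Y \<Longrightarrow> \<bar>\<eta> y\<bar> \<le> C"
    show "\<forall>\<^sub>F T in at_top. ereal (\<mu> - 2 * C * (1 / T)) \<le> v_T f k U Y y0 T"
      using eventually_gt_at_top[of 0]
    proof eventually_elim
      case (elim T)
      have "ereal (T * \<mu> - 2 * C) \<le> (INF u\<in>admissible_upto f U Y y0 T.
          ereal (LINT t:{0..T}|lebesgue. k (trajectory f y0 u t, u t)))"
        by (intro INF_greatest) (simp add: viable_trajectory.average_cost_ge
            [OF finite_horizon elim refl k feasible])
      then have "ereal (1 / T) * ereal (T * \<mu> - 2 * C) \<le> v_T f k U Y y0 T"
        unfolding v_T_def by (rule ereal_mult_left_mono) (use elim in simp)
      moreover have "ereal (1 / T) * ereal (T * \<mu> - 2 * C) = ereal (\<mu> - 2 * C * (1 / T))"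
        using elim by (simp add: field_simps)
      ultimately show ?case by simp
    qed
  qed simp
  moreover have "d_star f k U Y y0 \<le> Liminf (at_right 0) (h_disc f k U Y y0)"
  proof (rule d_star_le_Liminf[OF assms(5) _ tendsto_ident_at])
    fix \<mu> \<psi> \<eta> C
    assume feasible: "\<psi> \<in> C1" "\<eta> \<in> C1"
      "\<And>y v. y \<in> Y \<Longrightarrow> v \<in> U \<Longrightarrow> k (y, v) + (\<psi> y0 - \<psi> y) + grad \<eta> y \<bullet> f (y, v) - \<mu> \<ge> 0"
      "\<And>y v. y \<in> Y \<Longrightarrow> v \<in> U \<Longrightarrow> grad \<psi> y \<bullet> f (y, v) \<ge> 0"
      "\<And>y. y \<in> Y \<Longrightarrow> \<bar>\<eta> y\<bar> \<le> C"
    show "\<forall>\<^sub>F lam in at_right 0. ereal (\<mu> - 2 * C * lam) \<le> h_disc f k U Y y0 lam"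
      using eventually_at_right_less[of 0]
    proof eventually_elim
      case (elim lam)
      have "ereal (\<mu> / lam - 2 * C) \<le> (INF u\<in>admissible f U Y y0.
          ereal (LINT t:{0..}|lebesgue. exp (- lam * t) * k (trajectory f y0 u t, u t)))"
        using viable_trajectory.discounted_cost_ge[OF infinite_horizon elim refl k feasible]
        by (intro INF_greatest) simp
      then have "ereal lam * ereal (\<mu> / lam - 2 * C) \<le> h_disc f k U Y y0 lam"
        unfolding h_disc_def by (rule ereal_mult_left_mono) (use elim in simp)
      moreover have "ereal lam * ereal (\<mu> / lam - 2 * C) = ereal (\<mu> - 2 * C * lam)"
        using elim by (simp add: field_simps)
      ultimately show ?case by simp
    qed
  qed simp
  ultimately show ?thesis using averages discounted by blast
qed

end
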